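(* Let $f:(M,h)\to(N,g)$ be a holomorphic map between two Hermitian manifolds. Then the following inequality of real $(1,1)$-forms holds on $\mathbb P(f^*T^*_N)\to M$: $$\sqrt{-1}\,\partial\bar\partial\,\mathscr Y_1\ \ge\ \left(\sqrt{-1}\,\partial\bar\partial\log\mathscr H_1^{-1}\right)\cdot\mathscr Y_1+\frac{\sqrt{-1}\,R_{\alpha\bar\beta\gamma\bar\delta}\,h^{\gamma\bar\nu}h^{\mu\bar\delta}f^k_\mu\overline{f^\ell_\nu}\,X_k\overline{X_\ell}\,dz^\alpha\wedge d\bar z^\beta}{\mathscr H_1}.$$
   Context: $\{z^\alpha\}_{\alpha=1}^m$ and $\{\eta^i\}_{i=1}^n$ are local holomorphic coordinates on $M$ (near $p$) and $N$ (near $f(p)$); $h=(h_{\alpha\bar\beta})$, $g=(g_{i\bar j})$ with inverse matrices $h^{\alpha\bar\beta}$, $g^{i\bar j}$ (so $h^{\alpha\bar\beta}h_{\gamma\bar\beta}=\delta^\alpha_\gamma$, similarly for $g$); $f^i_\alpha=\partial f^i/\partial z^\alpha$. Repeated indices are summed. $\mathbb P(f^*T^*_N)\to M$ is the bundle of complex lines in the fibers of the holomorphic vector bundle $f^*T_N^*$ (where $T_N=T^{1,0}N$), and $(X_1,\dots,X_n)$ are the holomorphic coordinates on the fibers of $f^*T^*_N$ with respect to the frame $f^*d\eta^i$ (homogeneous coordinates on the fibers of $\mathbb P(f^*T_N^* )$). Set $\mathscr H_1=\sum g^{k\bar\ell}X_k\overline{X_\ell}$ and $$\mathscr Y_1=h^{\alpha\bar\beta}f^i_\alpha\overline{f^j_\beta}\,\frac{X_i\overline{X_j}}{\sum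 g^{k\bar\ell}X_k\overline{X_\ell}},$$ a function on $\mathbb P(f^*T^*_N)$. The form $\partial\bar\partial\log\mathscr H_1^{-1}$ is well defined on $\mathbb P(f^*T_N^* )$, and $dz^\alpha$ is pulled back to it. $R_{\alpha\bar\beta\gamma\bar\delta}=-\frac{\partial^2h_{\gamma\bar\delta}}{\partial z^\alpha\partial\bar z^\beta}+h^{\mu\bar\nu}\frac{\partial h_{\gamma\bar\nu}}{\partial z^\alpha}\frac{\partial h_{\mu\bar\delta}}{\partial\bar z^\beta}$ is the Chern curvature of $(M,h)$. For real $(1,1)$-forms, $A\ge B$ means that $A-B$ is semi-positive. *)

theory Defs
  imports "HOL-Analysis.Analysis"
begin

section \<open>Calculus on open subsets of \<open>\<complex>\<^sup>d\<close>\<close>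

text \<open>\<open>\<partial>/\<partial>z\<^sup>a = (\<partial>/\<partial>x\<^sup>a - i \<partial>/\<partial>y\<^sup>a)/2\<close> and its conjugate.\<close>

definition wirt :: "'d::finite \<Rightarrow> (complex^'d \<Rightarrow> complex) \<Rightarrow> complex^'d \<Rightarrow> complex" where
  "wirt a F x = (frechet_derivative F (at x) (axis a 1)
                 - \<i> * frechet_derivative F (at x) (axis a \<i>)) / 2"

definition wirt_bar :: "'d::finite \<Rightarrow> (complex^'d \<Rightarrow> complex) \<Rightarrow> complex^'d \<Rightarrow> complex" where
  "wirt_bar a F x = (frechet_derivative F (at x) (axis a 1)
                     + \<i> * frechet_derivative F (at x) (axis a \<i>)) / 2"

text \<open>Holomorphic maps of several variables: complex differentiability at every point
  (the set is always open below).\<close>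

definition holo_on :: "(complex^'m::finite) set \<Rightarrow> (complex^'m \<Rightarrow> complex^'n::finite) \<Rightarrow> bool" where
  "holo_on S F \<longleftrightarrow>
     (\<forall>x\<in>S. \<exists>J::complex^'m^'n. (F has_derivative (\<lambda>v. J *v v)) (at x))"

fun ck_on :: "nat \<Rightarrow> 'v::euclidean_space set \<Rightarrow> ('v \<Rightarrow> 'w::real_normed_vector) \<Rightarrow> bool" where
  "ck_on 0 S F \<longleftrightarrow> continuous_on S F"
| "ck_on (Suc k) S F \<longleftrightarrow>
     (\<forall>x\<in>S. F differentiable (at x)) \<and>
     (\<forall>b\<in>Basis. ck_on k S (\<lambda>x. frechet_derivative F (at x) b))"

definition smooth_on :: "'v::euclidean_space set \<Rightarrow> ('v \<Rightarrow> 'w::real_normed_vector) \<Rightarrow> bool" where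
  "smooth_on S F \<longleftrightarrow> (\<forall>k. ck_on k S F)"


section \<open>Complex manifolds and Hermitian metrics\<close>

text \<open>A chart is a coordinate neighbourhood together with its coordinate map. The underlying
  space of a manifold is a whole type.\<close>

type_synonym ('a, 'm) chart = "'a set \<times> ('a \<Rightarrow> complex^'m)"

definition coord_inv :: "('a, 'm::finite) chart \<Rightarrow> complex^'m \<Rightarrow> 'a" where
  "coord_inv c = inv_into (fst c) (snd c)"

definition transition :: "('a, 'm::finite) chart \<Rightarrow> ('a, 'm) chart \<Rightarrow> complex^'m \<Rightarrow> complex^'m" where
  "transition c c' z = snd c' (coord_inv c z)"

definition complex_atlas ::
    "('a::{t2_space,second_countable_topology}, 'm::finite) chart set \<Rightarrow> bool" where
  "complex_atlas A \<longleftrightarrow>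
     (\<Union>c\<in>A. fst c) = UNIV \<and>
     (\<forall>c\<in>A. open (fst c) \<and> open (snd c ` fst c) \<and>
            homeomorphism (fst c) (snd c ` fst c) (snd c) (coord_inv c)) \<and>
     (\<forall>c\<in>A. \<forall>c'\<in>A. holo_on (snd c ` (fst c \<inter> fst c')) (transition c c'))"

definition holomorphic_map ::
    "('a::{t2_space,second_countable_topology}, 'm::finite) chart set \<Rightarrow>
     ('b::{t2_space,second_countable_topology}, 'n::finite) chart set \<Rightarrow> ('a \<Rightarrow> 'b) \<Rightarrow> bool" where
  "holomorphic_map A B f \<longleftrightarrow>
     continuous_on UNIV f \<and>
     (\<forall>c\<in>A. \<forall>d\<in>B. holo_on (snd c ` (fst c \<inter> f -` fst d)) (\<lambda>z. snd d (f (coord_inv c z))))"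

definition hermitian_pos_def :: "complex^'m^'m::finite \<Rightarrow> bool" where
  "hermitian_pos_def H \<longleftrightarrow>
     (\<forall>\<alpha> \<beta>. H $ \<alpha> $ \<beta> = cnj (H $ \<beta> $ \<alpha>)) \<and>
     (\<forall>v. v \<noteq> 0 \<longrightarrow> 0 < Re (\<Sum>\<alpha>\<in>UNIV. \<Sum>\<beta>\<in>UNIV. H $ \<alpha> $ \<beta> * v $ \<alpha> * cnj (v $ \<beta>)))"

text \<open>A Hermitian metric is given by its component matrices \<open>h\<^sub>\<alpha>\<^sub>\<beta>\<close> (first index holomorphic,
  second index antiholomorphic) in every chart, which transform as a tensor.\<close>

definition hermitian_metric ::
    "('a::{t2_space,second_countable_topology}, 'm::finite) chart set \<Rightarrow>
     (('a, 'm) chart \<Rightarrow> 'a \<Rightarrow> complex^'m^'m) \<Rightarrow> bool" where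
  "hermitian_metric A h \<longleftrightarrow>
     (\<forall>c\<in>A. (\<forall>p\<in>fst c. hermitian_pos_def (h c p)) \<and>
            smooth_on (snd c ` fst c) (\<lambda>z. h c (coord_inv c z))) \<and>
     (\<forall>c\<in>A. \<forall>c'\<in>A. \<forall>p\<in>fst c \<inter> fst c'. \<forall>\<alpha> \<beta>.
        h c p $ \<alpha> $ \<beta> =
          (\<Sum>\<gamma>\<in>UNIV. \<Sum>\<delta>\<in>UNIV.
             wirt \<alpha> (\<lambda>z. transition c c' z $ \<gamma>) (snd c p) *
             cnj (wirt \<beta> (\<lambda>z. transition c c' z $ \<delta>) (snd c p)) *
             h c' p $ \<gamma> $ \<delta>))"

text \<open>The convention \<open>h\<^sup>\<alpha>\<^sup>\<beta> h\<^sub>\<gamma>\<^sub>\<beta> = \<delta>\<^sup>\<alpha>\<^sub>\<gamma>\<close> contracts the second indices, whence the transpose.\<close>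

definition inv_metric :: "complex^'m^'m::finite \<Rightarrow> complex^'m^'m" where
  "inv_metric H = matrix_inv (transpose H)"

definition chern_curv ::
    "(('a, 'm::finite) chart \<Rightarrow> 'a \<Rightarrow> complex^'m^'m) \<Rightarrow> ('a, 'm) chart \<Rightarrow> 'a \<Rightarrow>
     'm \<Rightarrow> 'm \<Rightarrow> 'm \<Rightarrow> 'm \<Rightarrow> complex" where
  "chern_curv h c p \<alpha> \<beta> \<gamma> \<delta> =
     (let H = (\<lambda>\<mu> \<nu> z. h c (coord_inv c z) $ \<mu> $ \<nu>); z0 = snd c p in
      - wirt \<alpha> (wirt_bar \<beta> (H \<gamma> \<delta>)) z0
      + (\<Sum>\<mu>\<in>UNIV. \<Sum>\<nu>\<in>UNIV.
           inv_metric (h c p) $ \<mu> $ \<nu> * wirt \<alpha> (H \<gamma> \<nu>) z0 * wirt_bar \<beta> (H \<mu> \<delta>) z0))"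


section \<open>The projectivized bundle \<open>\<P>(f\<^sup>*T\<^sub>N\<^sup>*)\<close>\<close>

text \<open>A \<open>(1,0)\<close>-covector at \<open>q\<close> is the family of its components \<open>X\<^sub>i\<close> with respect to the frames
  \<open>d\<eta>\<^sup>i\<close> of all charts around \<open>q\<close> (and \<open>0\<close> elsewhere).\<close>

definition cotangent ::
    "('b, 'n::finite) chart set \<Rightarrow> 'b \<Rightarrow> (('b, 'n) chart \<Rightarrow> complex^'n) set" where
  "cotangent B q =
     {\<xi>. (\<forall>d. d \<notin> B \<or> q \<notin> fst d \<longrightarrow> \<xi> d = 0) \<and>
          (\<forall>d\<in>B. \<forall>d'\<in>B. q \<in> fst d \<inter> fst d' \<longrightarrow>
             (\<forall>i. \<xi> d $ i =
                (\<Sum>k\<in>UNIV. wirt i (\<lambda>\<eta>. transition d d' \<eta> $ k) (snd d q) * \<xi> d' $ k)))}"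

text \<open>Points: pairs of a point \<open>p\<close> of \<open>M\<close> and a complex line in the cotangent space of \<open>N\<close> at \<open>f p\<close>.\<close>

definition proj_bundle ::
    "('b, 'n::finite) chart set \<Rightarrow> ('a \<Rightarrow> 'b) \<Rightarrow> ('a \<times> (('b, 'n) chart \<Rightarrow> complex^'n) set) set" where
  "proj_bundle B f =
     {(p, L). \<exists>\<xi>\<in>cotangent B (f p). \<xi> \<noteq> (\<lambda>_. 0) \<and> L = range (\<lambda>t::complex. \<lambda>d. t *s \<xi> d)}"

text \<open>Homogeneous coordinates are only determined up to a nonzero factor; everything below that
  uses them directly is homogeneous of degree 0.\<close>

definition homog :: "('b, 'n::finite) chart \<Rightarrow> (('b, 'n) chart \<Rightarrow> complex^'n) set \<Rightarrow> complex^'n" where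
  "homog d L = (SOME X. X \<noteq> 0 \<and> X \<in> (\<lambda>\<xi>. \<xi> d) ` L)"

definition affine_coords ::
    "('b, 'n::finite) chart \<Rightarrow> 'n \<Rightarrow> (('b, 'n) chart \<Rightarrow> complex^'n) set \<Rightarrow> complex^'n" where
  "affine_coords d j L = (\<chi> i. homog d L $ i / homog d L $ j)"

text \<open>Charts \<open>c\<close> of \<open>M\<close>, \<open>d\<close> of \<open>N\<close> and an index \<open>j\<close> give the chart of the projectivized bundle on
  \<open>X\<^sub>j \<noteq> 0\<close> with coordinates \<open>\<zeta> = (z\<^sup>\<alpha>, X\<^sub>i/X\<^sub>j)\<close>. They are stored as a vector indexed by
  \<open>'m + 'n\<close> whose entry at \<open>Inr j\<close> is the constant 1; so the actual coordinates are those with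
  index in \<open>UNIV - {Inr j}\<close>.\<close>

definition bundle_dom ::
    "('b, 'n::finite) chart set \<Rightarrow> ('a \<Rightarrow> 'b) \<Rightarrow> ('a, 'm::finite) chart \<Rightarrow> ('b, 'n) chart \<Rightarrow> 'n \<Rightarrow>
     ('a \<times> (('b, 'n) chart \<Rightarrow> complex^'n) set) set" where
  "bundle_dom B f c d j =
     {(p, L) \<in> proj_bundle B f. p \<in> fst c \<and> f p \<in> fst d \<and> homog d L $ j \<noteq> 0}"

definition bundle_chart ::
    "('a, 'm::finite) chart \<Rightarrow> ('b, 'n::finite) chart \<Rightarrow> 'n \<Rightarrow>
     'a \<times> (('b, 'n) chart \<Rightarrow> complex^'n) set \<Rightarrow> complex^('m + 'n)" where
  "bundle_chart c d j x =
     (\<chi> k. case k of Inl \<alpha> \<Rightarrow> snd c (fst x) $ \<alpha> | Inr i \<Rightarrow> affine_coords d j (snd x) $ i)"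

text \<open>Coordinate expression of a function on the projectivized bundle, extended to be independent
  of the dummy coordinate \<open>Inr j\<close>.\<close>

definition in_coords ::
    "('b, 'n::finite) chart set \<Rightarrow> ('a \<Rightarrow> 'b) \<Rightarrow> ('a, 'm::finite) chart \<Rightarrow> ('b, 'n) chart \<Rightarrow> 'n \<Rightarrow>
     ('a \<times> (('b, 'n) chart \<Rightarrow> complex^'n) set \<Rightarrow> complex) \<Rightarrow> complex^('m + 'n) \<Rightarrow> complex" where
  "in_coords B f c d j F \<zeta> =
     F (inv_into (bundle_dom B f c d j) (bundle_chart c d j)
          (\<chi> k. if k = Inr j then 1 else \<zeta> $ k))"


section \<open>Real \<open>(1,1)\<close>-forms\<close>

text \<open>In a coordinate system \<open>(\<zeta>\<^sup>a)\<close>, \<open>a \<in> I\<close>, a \<open>(1,1)\<close>-form \<open>i \<Sum> Q\<^sub>a\<^sub>b d\<zeta>\<^sup>a \<and> d\<zeta>\<^sup>b\<^sup>-\<close> at a point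
  is represented by its coefficients \<open>Q\<^sub>a\<^sub>b\<close>, with the factor \<open>i\<close> split off. It is real iff \<open>Q\<close> is
  Hermitian, and semi-positive iff \<open>Q\<close> is positive semidefinite.\<close>

definition real_form :: "'d set \<Rightarrow> complex^'d^'d::finite \<Rightarrow> bool" where
  "real_form I Q \<longleftrightarrow> (\<forall>a\<in>I. \<forall>b\<in>I. Q $ a $ b = cnj (Q $ b $ a))"

definition semipositive_form :: "'d set \<Rightarrow> complex^'d^'d::finite \<Rightarrow> bool" where
  "semipositive_form I Q \<longleftrightarrow>
     real_form I Q \<and>
     (\<forall>v::complex^'d. 0 \<le> Re (\<Sum>a\<in>I. \<Sum>b\<in>I. Q $ a $ b * v $ a * cnj (v $ b)))"

definition form_ge :: "'d set \<Rightarrow> complex^'d^'d::finite \<Rightarrow> complex^'d^'d \<Rightarrow> bool" where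
  "form_ge I P Q \<longleftrightarrow> real_form I P \<and> real_form I Q \<and> semipositive_form I (P - Q)"

text \<open>Coefficients of \<open>i\<partial>\<partial>\<^sup>-F\<close> at the point \<open>x\<close> of the projectivized bundle.\<close>

definition ddbar ::
    "('b, 'n::finite) chart set \<Rightarrow> ('a \<Rightarrow> 'b) \<Rightarrow> ('a, 'm::finite) chart \<Rightarrow> ('b, 'n) chart \<Rightarrow> 'n \<Rightarrow>
     ('a \<times> (('b, 'n) chart \<Rightarrow> complex^'n) set \<Rightarrow> complex) \<Rightarrow>
     'a \<times> (('b, 'n) chart \<Rightarrow> complex^'n) set \<Rightarrow> complex^('m + 'n)^('m + 'n)" where
  "ddbar B f c d j F x =
     (\<chi> a b. wirt a (wirt_bar b (in_coords B f c d j F)) (bundle_chart c d j x))"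


section \<open>The function Y1, the form of log H1, and the curvature form\<close>

definition fpartial ::
    "('a \<Rightarrow> 'b) \<Rightarrow> ('a, 'm::finite) chart \<Rightarrow> ('b, 'n::finite) chart \<Rightarrow> 'a \<Rightarrow> 'n \<Rightarrow> 'm \<Rightarrow> complex" where
  "fpartial f c d p i \<alpha> = wirt \<alpha> (\<lambda>z. snd d (f (coord_inv c z)) $ i) (snd c p)"

definition H1 ::
    "(('b, 'n::finite) chart \<Rightarrow> 'b \<Rightarrow> complex^'n^'n) \<Rightarrow> ('b, 'n) chart \<Rightarrow> 'b \<Rightarrow> complex^'n \<Rightarrow> complex" where
  "H1 g d q X = (\<Sum>k\<in>UNIV. \<Sum>l\<in>UNIV. inv_metric (g d q) $ k $ l * X $ k * cnj (X $ l))"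

definition Y1 ::
    "(('a, 'm::finite) chart \<Rightarrow> 'a \<Rightarrow> complex^'m^'m) \<Rightarrow> (('b, 'n::finite) chart \<Rightarrow> 'b \<Rightarrow> complex^'n^'n) \<Rightarrow>
     ('a \<Rightarrow> 'b) \<Rightarrow> ('a, 'm) chart \<Rightarrow> ('b, 'n) chart \<Rightarrow>
     'a \<times> (('b, 'n) chart \<Rightarrow> complex^'n) set \<Rightarrow> complex" where
  "Y1 h g f c d x =
     (let p = fst x; X = homog d (snd x) in
      \<Sum>\<alpha>\<in>UNIV. \<Sum>\<beta>\<in>UNIV. \<Sum>i\<in>UNIV. \<Sum>j\<in>UNIV.
        inv_metric (h c p) $ \<alpha> $ \<beta> * fpartial f c d p i \<alpha> * cnj (fpartial f c d p j \<beta>) *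
        (X $ i * cnj (X $ j) / H1 g d (f p) X))"

text \<open>\<open>\<H>\<^sub>1\<close> is a function on the total space of the bundle only. The form
  \<open>\<partial>\<partial>\<^sup>-log \<H>\<^sub>1\<^sup>-\<^sup>1\<close> on the projectivization is computed from any nonvanishing local holomorphic
  choice of representative; on \<open>X\<^sub>j \<noteq> 0\<close> we take the one with \<open>X\<^sub>j = 1\<close>.\<close>

definition log_inv_H1 ::
    "(('b, 'n::finite) chart \<Rightarrow> 'b \<Rightarrow> complex^'n^'n) \<Rightarrow> ('a \<Rightarrow> 'b) \<Rightarrow> ('b, 'n) chart \<Rightarrow> 'n \<Rightarrow>
     'a \<times> (('b, 'n) chart \<Rightarrow> complex^'n) set \<Rightarrow> complex" where
  "log_inv_H1 g f d j x = ln (inverse (H1 g d (f (fst x)) (affine_coords d j (snd x))))"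

text \<open>The pulled-back forms \<open>dz\<^sup>\<alpha>\<close> have only \<open>Inl\<close> components.\<close>

definition curv_form ::
    "(('a, 'm::finite) chart \<Rightarrow> 'a \<Rightarrow> complex^'m^'m) \<Rightarrow> (('b, 'n::finite) chart \<Rightarrow> 'b \<Rightarrow> complex^'n^'n) \<Rightarrow>
     ('a \<Rightarrow> 'b) \<Rightarrow> ('a, 'm) chart \<Rightarrow> ('b, 'n) chart \<Rightarrow>
     'a \<times> (('b, 'n) chart \<Rightarrow> complex^'n) set \<Rightarrow> complex^('m + 'n)^('m + 'n)" where
  "curv_form h g f c d x =
     (let p = fst x; X = homog d (snd x); hi = inv_metric (h c p) in
      \<chi> a b. case (a, b) of
        (Inl \<alpha>, Inl \<beta>) \<Rightarrow>
          (\<Sum>\<gamma>\<in>UNIV. \<Sum>\<delta>\<in>UNIV. \<Sum>\<mu>\<in>UNIV. \<Sum>\<nu>\<in>UNIV. \<Sum>k\<in>UNIV. \<Sum>l\<in>UNIV.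
             chern_curv h c p \<alpha> \<beta> \<gamma> \<delta> * hi $ \<gamma> $ \<nu> * hi $ \<mu> $ \<delta> *
             fpartial f c d p k \<mu> * cnj (fpartial f c d p l \<nu>) * X $ k * cnj (X $ l))
          / H1 g d (f p) X
      | _ \<Rightarrow> 0)"

end

theory Submission
  imports Defs "HOL-Complex_Analysis.Cauchy_Integral_Formula"
begin

text \<open>
In the coordinates \<open>(z, X)\<close> with \<open>X\<^sub>j = 1\<close> the function \<open>\<Y>\<^sub>1\<close> is \<open>\<Phi>/G\<close>, where \<open>\<Phi> = V K V\<^sup>*\<close> for the
row vector \<open>V\<^sub>\<alpha> = f\<^sup>i\<^sub>\<alpha> X\<^sub>i\<close> and the inverse metric \<open>K\<close>, and \<open>G\<close> is the coordinate expression of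
\<open>\<H>\<^sub>1\<close>. The point is that \<open>V\<close> is holomorphic in all coordinates together. Write \<open>T = K\<^sup>-\<^sup>1\<close> (the
transposed metric), \<open>p\<^sub>a = \<partial>\<^sub>a log G\<close>, and let a bar on an index denote a derivative in the conjugate
direction.

The quotient rule alone gives
\<open>\<partial>\<^sub>a\<partial>\<^sub>b\<^sub>-\<Y>\<^sub>1 - \<Y>\<^sub>1 \<partial>\<^sub>a\<partial>\<^sub>b\<^sub>-(log G\<^sup>-\<^sup>1) = (\<Phi>\<^sub>a\<^sub>b\<^sub>- - \<Phi>\<^sub>a p\<^sub>b\<^sub>- - \<Phi>\<^sub>b\<^sub>- p\<^sub>a + \<Phi> p\<^sub>a p\<^sub>b\<^sub>-)/G\<close>
(lemma \<open>wirtinger_quotient\<close>). In \<open>\<Phi>\<^sub>a\<^sub>b\<^sub>-\<close> the derivatives of \<open>K\<close> are replaced by derivatives of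
\<open>T\<close> through \<open>\<partial>K = -K (\<partial>T) K\<close>. The second derivative of \<open>K\<close> then produces the curvature term
\<open>K (T\<^sub>b\<^sub>- K T\<^sub>a - T\<^sub>a\<^sub>b\<^sub>-) K\<close> and one further term \<open>K T\<^sub>a K T\<^sub>b\<^sub>- K\<close>, which is exactly what completes the
remaining terms to a square:
\<open>\<partial>\<^sub>a\<partial>\<^sub>b\<^sub>-\<Y>\<^sub>1 - \<Y>\<^sub>1 \<partial>\<^sub>a\<partial>\<^sub>b\<^sub>-(log G\<^sup>-\<^sup>1) - (curvature)/G = S\<^sub>a K S\<^sub>b\<^sup>* / G\<close> with
\<open>S\<^sub>a = \<partial>\<^sub>aV - V K T\<^sub>a - p\<^sub>a V\<close>
(lemmas \<open>dotc_square_completion\<close> and \<open>wirtinger_square_formula\<close>). This is a Gram matrix for the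
positive form \<open>K\<close> divided by \<open>G > 0\<close>, hence semi-positive; since the mixed second derivatives of the
real function \<open>\<Y>\<^sub>1\<close> form a Hermitian matrix, the right-hand side of the inequality is a real form
as well (lemma \<open>form_ge_of_square\<close>).

Two kinds of groundwork support this computation. Analytically, a function that is complex
differentiable at every point of an open set has complex differentiable partial derivatives (lemma
\<open>complex_diff_directional_derivative\<close>), so that \<open>V\<close> can be differentiated twice, and second
derivatives are symmetric (lemma \<open>second_derivative_symmetric\<close>). Geometrically, the inverse of a
chart of the projectivized bundle must be known explicitly: a covector can be prescribed in one chart
of \<open>N\<close> and extends to all others by the cocycle rule for the Jacobians of the transition maps
(lemmas \<open>cotangent_extend\<close> and \<open>bundle_chart_inverse\<close>).
\<close>

section \<open>Functions that are twice differentiable at a point\<close>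

lemma linear_expansion:
  fixes L :: "'v::euclidean_space \<Rightarrow> 'w::real_normed_vector"
  assumes "linear L"
  shows "L v = (\<Sum>b\<in>Basis. (v \<bullet> b) *\<^sub>R L b)"
proof -
  have "L v = L (\<Sum>b\<in>Basis. (v \<bullet> b) *\<^sub>R b)" by (simp only: euclidean_representation)
  also have "\<dots> = (\<Sum>b\<in>Basis. (v \<bullet> b) *\<^sub>R L b)"
    by (simp add: linear_sum[OF assms] linear_scale[OF assms])
  finally show ?thesis .
qed

text \<open>Differentiability of the first derivative is asked for each fixed direction \<open>v\<close>. This weak
pointwise form is closed under all the operations below, and it already makes the second derivative
symmetric.\<close>

definition twice_diff :: "('v::euclidean_space \<Rightarrow> 'w::real_normed_vector) \<Rightarrow> 'v \<Rightarrow> bool" where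
  "twice_diff F x \<longleftrightarrow>
     (\<exists>F'. (\<forall>\<^sub>F y in nhds x. (F has_derivative F' y) (at y)) \<and>
           (\<forall>v. (\<lambda>y. F' y v) differentiable (at x)))"

lemma twice_diffI:
  assumes "\<forall>\<^sub>F y in nhds x. (F has_derivative F' y) (at y)"
    and "\<And>v. (\<lambda>y. F' y v) differentiable (at x)"
  shows "twice_diff F x"
  using assms unfolding twice_diff_def by blast

lemma twice_diff_imp_differentiable:
  "twice_diff F x \<Longrightarrow> F differentiable (at x)"
  unfolding twice_diff_def differentiable_def by (auto dest: eventually_nhds_x_imp_x)

lemma twice_diff_eventually_differentiable:
  "twice_diff F x \<Longrightarrow> \<forall>\<^sub>F y in nhds x. F differentiable (at y)"
  unfolding twice_diff_def differentiable_def by (auto elim: eventually_mono)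

lemma has_derivative_cong_nhds:
  assumes F: "(F has_derivative D) (at x)" and ev: "\<forall>\<^sub>F y in nhds x. F y = G y"
  shows "(G has_derivative D) (at x)"
proof (rule has_derivative_transform_eventually[OF F])
  show "\<forall>\<^sub>F y in at x. F y = G y"
    using ev unfolding eventually_at_filter by (rule eventually_mono) simp
  show "F x = G x" using ev by (rule eventually_nhds_x_imp_x)
qed simp

lemma twice_diff_cong:
  assumes "twice_diff F x" and ev: "\<forall>\<^sub>F y in nhds x. F y = G y"
  shows "twice_diff G x"
proof -
  obtain F' where F': "\<forall>\<^sub>F y in nhds x. (F has_derivative F' y) (at y)"
      "\<And>v. (\<lambda>y. F' y v) differentiable (at x)"
    using assms(1) unfolding twice_diff_def by blast
  have "\<forall>\<^sub>F y in nhds x. \<forall>\<^sub>F z in nhds y. F z = G z" using ev by (simp add: eventually_eventually)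
  with F'(1) have "\<forall>\<^sub>F y in nhds x. (G has_derivative F' y) (at y)"
    by eventually_elim (rule has_derivative_cong_nhds)
  then show ?thesis using F'(2) by (rule twice_diffI)
qed

lemma twice_diff_const [simp]: "twice_diff (\<lambda>y. c) x"
  by (rule twice_diffI[where F' = "\<lambda>y v. 0"]) auto

lemma twice_diff_bounded_linear:
  assumes L: "bounded_linear L" and F: "twice_diff F x"
  shows "twice_diff (\<lambda>y. L (F y)) x"
proof -
  obtain F' where F': "\<forall>\<^sub>F y in nhds x. (F has_derivative F' y) (at y)"
      "\<And>v. (\<lambda>y. F' y v) differentiable (at x)"
    using F unfolding twice_diff_def by blast
  show ?thesis
  proof (rule twice_diffI)
    show "\<forall>\<^sub>F y in nhds x. ((\<lambda>y. L (F y)) has_derivative (\<lambda>v. L (F' y v))) (at y)"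
      using F'(1) by (rule eventually_mono) (rule bounded_linear.has_derivative[OF L])
    show "(\<lambda>y. L (F' y v)) differentiable at x" for v
      using F'(2)[of v] bounded_linear.has_derivative[OF L] unfolding differentiable_def by blast
  qed
qed

lemma twice_diff_add:
  assumes "twice_diff F x" "twice_diff G x"
  shows "twice_diff (\<lambda>y. F y + G y) x"
proof -
  obtain F' where F': "\<forall>\<^sub>F y in nhds x. (F has_derivative F' y) (at y)"
      "\<And>v. (\<lambda>y. F' y v) differentiable (at x)"
    using assms(1) unfolding twice_diff_def by blast
  obtain G' where G': "\<forall>\<^sub>F y in nhds x. (G has_derivative G' y) (at y)"
      "\<And>v. (\<lambda>y. G' y v) differentiable (at x)"
    using assms(2) unfolding twice_diff_def by blast
  show ?thesis
  proof (rule twice_diffI)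
    show "\<forall>\<^sub>F y in nhds x. ((\<lambda>y. F y + G y) has_derivative (\<lambda>v. F' y v + G' y v)) (at y)"
      using F'(1) G'(1) by eventually_elim (rule has_derivative_add)
    show "(\<lambda>y. F' y v + G' y v) differentiable at x" for v
      by (intro differentiable_add F' G')
  qed
qed

lemma twice_diff_mult:
  fixes F G :: "'v::euclidean_space \<Rightarrow> 'w::real_normed_algebra"
  assumes "twice_diff F x" "twice_diff G x"
  shows "twice_diff (\<lambda>y. F y * G y) x"
proof -
  obtain F' where F': "\<forall>\<^sub>F y in nhds x. (F has_derivative F' y) (at y)"
      "\<And>v. (\<lambda>y. F' y v) differentiable (at x)"
    using assms(1) unfolding twice_diff_def by blast
  obtain G' where G': "\<forall>\<^sub>F y in nhds x. (G has_derivative G' y) (at y)"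
      "\<And>v. (\<lambda>y. G' y v) differentiable (at x)"
    using assms(2) unfolding twice_diff_def by blast
  show ?thesis
  proof (rule twice_diffI)
    show "\<forall>\<^sub>F y in nhds x. ((\<lambda>y. F y * G y) has_derivative (\<lambda>v. F y * G' y v + F' y v * G y)) (at y)"
      using F'(1) G'(1) by eventually_elim (rule has_derivative_mult)
    show "(\<lambda>y. F y * G' y v + F' y v * G y) differentiable at x" for v
      by (intro differentiable_add differentiable_mult F' G' twice_diff_imp_differentiable assms)
  qed
qed

lemma twice_diff_inverse:
  fixes F :: "'v::euclidean_space \<Rightarrow> complex"
  assumes "twice_diff F x" "F x \<noteq> 0"
  shows "twice_diff (\<lambda>y. inverse (F y)) x"
proof -
  obtain F' where F': "\<forall>\<^sub>F y in nhds x. (F has_derivative F' y) (at y)"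
      "\<And>v. (\<lambda>y. F' y v) differentiable (at x)"
    using assms(1) unfolding twice_diff_def by blast
  have "isCont F x"
    using differentiable_imp_continuous_within twice_diff_imp_differentiable[OF assms(1)] by blast
  then have "\<forall>\<^sub>F y in nhds x. F y \<noteq> 0"
    using assms(2) by (metis tendsto_imp_eventually_ne isCont_def tendsto_at_iff_tendsto_nhds)
  with F'(1) have ev: "\<forall>\<^sub>F y in nhds x. ((\<lambda>y. inverse (F y)) has_derivative
        (\<lambda>v. - (inverse (F y) * F' y v * inverse (F y)))) (at y)"
    by eventually_elim (rule Deriv.has_derivative_inverse)
  show ?thesis
  proof (rule twice_diffI[OF ev])
    show "(\<lambda>y. - (inverse (F y) * F' y v * inverse (F y))) differentiable at x" for v
      by (intro differentiable_minus differentiable_mult F' differentiable_inverse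
          twice_diff_imp_differentiable assms)
  qed
qed

lemma twice_diff_sum:
  assumes "\<And>i. i \<in> I \<Longrightarrow> twice_diff (F i) x"
  shows "twice_diff (\<lambda>y. \<Sum>i\<in>I. F i y) x"
  using assms by (induction I rule: infinite_finite_induct) (auto intro!: twice_diff_add)

lemma twice_diff_prod:
  fixes F :: "'i \<Rightarrow> 'v::euclidean_space \<Rightarrow> complex"
  assumes "\<And>i. i \<in> I \<Longrightarrow> twice_diff (F i) x"
  shows "twice_diff (\<lambda>y. \<Prod>i\<in>I. F i y) x"
  using assms by (induction I rule: infinite_finite_induct) (auto intro!: twice_diff_mult)

lemma twice_diff_cnj: "twice_diff F x \<Longrightarrow> twice_diff (\<lambda>y. cnj (F y)) x"
  by (rule twice_diff_bounded_linear[OF bounded_linear_cnj])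

lemma twice_diff_component:
  fixes F :: "'v::euclidean_space \<Rightarrow> 'b::real_normed_vector^'n::finite"
  shows "twice_diff F x \<Longrightarrow> twice_diff (\<lambda>y. F y $ i) x"
  by (rule twice_diff_bounded_linear[OF bounded_linear_vec_nth])

text \<open>Expanding the outer derivative over the standard basis leaves only finitely many fixed directions,
for which \<open>twice_diff\<close> provides the second derivative.\<close>

lemma twice_diff_compose:
  fixes P :: "'v::euclidean_space \<Rightarrow> 'w::euclidean_space" and M :: "'w \<Rightarrow> 'z::real_normed_vector"
  assumes M: "twice_diff M (P x)" and P: "twice_diff P x"
  shows "twice_diff (\<lambda>y. M (P y)) x"
proof -
  obtain M' where M': "\<forall>\<^sub>F y in nhds (P x). (M has_derivative M' y) (at y)"
      "\<And>v. (\<lambda>y. M' y v) differentiable (at (P x))"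
    using M unfolding twice_diff_def by blast
  obtain P' where P': "\<forall>\<^sub>F y in nhds x. (P has_derivative P' y) (at y)"
      "\<And>v. (\<lambda>y. P' y v) differentiable (at x)"
    using P unfolding twice_diff_def by blast
  have "isCont P x"
    using differentiable_imp_continuous_within twice_diff_imp_differentiable[OF P] by blast
  then have "\<forall>\<^sub>F y in nhds x. (M has_derivative M' (P y)) (at (P y))"
    by (intro eventually_compose_filterlim[OF M'(1)]) (simp add: isCont_def tendsto_at_iff_tendsto_nhds)
  with P'(1) have ev: "\<forall>\<^sub>F y in nhds x. ((\<lambda>y. M (P y)) has_derivative
        (\<lambda>v. \<Sum>b\<in>Basis. (P' y v \<bullet> b) *\<^sub>R M' (P y) b)) (at y)"
  proof eventually_elim
    case (elim y)
    have "((\<lambda>y. M (P y)) has_derivative (\<lambda>v. M' (P y) (P' y v))) (at y)"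
      using has_derivative_compose[OF elim] .
    then show ?case
      by (rule has_derivative_eq_rhs)
         (intro ext linear_expansion has_derivative_linear[OF elim(2)])
  qed
  have "(\<lambda>y. M' (P y) b) differentiable at x" for b
    using differentiable_chain_at[OF twice_diff_imp_differentiable[OF P] M'(2)[of b]]
    by (simp add: o_def)
  note D = this
  show ?thesis
  proof (rule twice_diffI[OF ev])
    show "(\<lambda>y. \<Sum>b\<in>Basis. (P' y v \<bullet> b) *\<^sub>R M' (P y) b) differentiable at x" for v
      by (intro differentiable_sum finite_Basis ballI differentiable_scaleR differentiable_inner
          P'(2) differentiable_const D)
  qed
qed

lemma twice_diff_bounded_linear_fun:
  assumes "bounded_linear L" shows "twice_diff L x"
  by (rule twice_diffI[where F' = "\<lambda>y. L"]) (auto intro!: always_eventually bounded_linear_imp_has_derivative assms)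

lemma twice_diff_if_smooth_on:
  assumes S: "open S" "x \<in> S" and F: "smooth_on S F"
  shows "twice_diff F x"
proof -
  have "ck_on (Suc (Suc 0)) S F" using F unfolding smooth_on_def by blast
  then have 1: "\<And>y. y \<in> S \<Longrightarrow> F differentiable at y"
    and 2: "\<And>b. b \<in> Basis \<Longrightarrow> (\<lambda>y. frechet_derivative F (at y) b) differentiable at x"
    using S by auto
  have ev: "\<forall>\<^sub>F y in nhds x. (F has_derivative
       (\<lambda>v. \<Sum>b\<in>Basis. (v \<bullet> b) *\<^sub>R frechet_derivative F (at y) b)) (at y)"
    unfolding eventually_nhds
  proof (intro exI[of _ S] conjI ballI S)
    fix y assume "y \<in> S"
    then have *: "(F has_derivative frechet_derivative F (at y)) (at y)"
      using 1 frechet_derivative_works by blast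
    then show "(F has_derivative
       (\<lambda>v. \<Sum>b\<in>Basis. (v \<bullet> b) *\<^sub>R frechet_derivative F (at y) b)) (at y)"
      by (rule has_derivative_eq_rhs) (intro ext linear_expansion has_derivative_linear[OF *])
  qed
  show ?thesis
    by (rule twice_diffI[OF ev])
       (intro differentiable_sum finite_Basis ballI differentiable_scaleR differentiable_const 2)
qed

text \<open>The second difference is the increment over \<open>[0, 1]\<close> of
\<open>s \<mapsto> F (x + t u + s t v) - F (x + s t v)\<close>, and the derivative of this path is
\<open>t\<^sup>2 D u\<close> up to \<open>o(t\<^sup>2)\<close> because \<open>y \<mapsto> F' y v\<close> is differentiable at \<open>x\<close>. The mean value
inequality then gives the bound.\<close>

lemma second_difference_estimate:
  fixes F :: "'v::euclidean_space \<Rightarrow> 'w::real_normed_vector"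
  assumes F: "\<forall>\<^sub>F y in nhds x. (F has_derivative F' y) (at y)"
    and D: "((\<lambda>y. F' y v) has_derivative D) (at x)" and e: "e > 0"
  shows "\<forall>\<^sub>F t in at_right 0. norm (F (x + t *\<^sub>R u + t *\<^sub>R v) - F (x + t *\<^sub>R u) - F (x + t *\<^sub>R v) + F x
            - t\<^sup>2 *\<^sub>R D u) \<le> e * t\<^sup>2"
proof -
  define C where "C = 2 * (norm u + norm v) + 1"
  have C: "C > 0" unfolding C_def by (simp add: add_nonneg_pos)
  obtain d1 where d1: "d1 > 0" "\<And>y. dist y x < d1 \<Longrightarrow> (F has_derivative F' y) (at y)"
    using F unfolding eventually_nhds_metric by blast
  obtain d2 where d2: "d2 > 0" "\<And>y. norm (y - x) < d2 \<Longrightarrow>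
      norm (F' y v - F' x v - D (y - x)) \<le> e / C * norm (y - x)"
    using D e C unfolding has_derivative_at_alt by (meson divide_pos_pos)
  interpret D: bounded_linear D using D by (rule has_derivative_bounded_linear)
  \<comment> \<open>Every corner of the parallelogram with sides \<open>t u\<close> and \<open>t v\<close> is within \<open>t C\<close> of \<open>x\<close>, and the
  choice of \<open>C\<close> leaves room for the two error terms at \<open>p 0 s\<close> and \<open>p 1 s\<close>.\<close>
  define d where "d = min d1 d2 / C"
  have d: "d > 0" using d1 d2 C by (simp add: d_def)
  have "norm (F (x + t *\<^sub>R u + t *\<^sub>R v) - F (x + t *\<^sub>R u) - F (x + t *\<^sub>R v) + F x
            - t\<^sup>2 *\<^sub>R D u) \<le> e * t\<^sup>2" if t: "0 < t" "t < d" for t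
  proof -
    have tC: "t * C < d1" "t * C < d2"
      using t C unfolding d_def by (auto simp: field_simps min_def split: if_splits)
    define p where "p a s = x + a *\<^sub>R (t *\<^sub>R u) + s *\<^sub>R (t *\<^sub>R v)" for a s :: real
    have pn: "norm (p a s - x) \<le> t * (norm u + norm v)" if "s \<in> {0..1}" "a \<in> {0..1}" for a s
    proof -
      have "norm (p a s - x) \<le> norm (a *\<^sub>R (t *\<^sub>R u)) + norm (s *\<^sub>R (t *\<^sub>R v))"
        unfolding p_def by (metis add.assoc add_diff_cancel_left' norm_triangle_ineq)
      also have "\<dots> \<le> 1 * (t * norm u) + 1 * (t * norm v)"
        using that t by (intro add_mono) (auto intro!: mult_left_le_one_le)
      finally show ?thesis by (simp add: algebra_simps)
    qed
    have tn: "t * (norm u + norm v) < t * C" "2 * (t * (norm u + norm v)) \<le> t * C" 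
    proof -
      have "t * C = 2 * (t * (norm u + norm v)) + t" by (simp add: C_def algebra_simps)
      moreover have "t * (norm u + norm v) \<ge> 0" using t by simp
      ultimately show "t * (norm u + norm v) < t * C" "2 * (t * (norm u + norm v)) \<le> t * C"
        using t by linarith+
    qed
    have pd: "norm (p a s - x) < d1" "norm (p a s - x) < d2" if "s \<in> {0..1}" "a \<in> {0..1}" for a s
      using pn[OF that] tn tC by linarith+
    define q where "q s = F (p 1 s) - F (p 0 s) - s *\<^sub>R (t\<^sup>2 *\<^sub>R D u)" for s
    have der: "((\<lambda>s. F (p a s)) has_derivative (\<lambda>h. F' (p a s) (h *\<^sub>R (t *\<^sub>R v)))) (at s within {0..1})"
      if "s \<in> {0..1}" "a \<in> {0..1}" for a s
    proof (rule has_derivative_compose[where g = F])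
      show "(p a has_derivative (\<lambda>h. h *\<^sub>R (t *\<^sub>R v))) (at s within {0..1})"
        unfolding p_def by (auto intro!: derivative_eq_intros)
      show "(F has_derivative F' (p a s)) (at (p a s))"
        using pd(1)[OF that] by (intro d1) (simp add: dist_norm)
    qed
    have q': "(q has_derivative (\<lambda>h. F' (p 1 s) (h *\<^sub>R (t *\<^sub>R v)) - F' (p 0 s) (h *\<^sub>R (t *\<^sub>R v))
                 - h *\<^sub>R (t\<^sup>2 *\<^sub>R D u))) (at s within {0..1})" if "s \<in> {0..1}" for s
      unfolding q_def using that by (auto intro!: derivative_eq_intros der)
    have bound: "onorm (\<lambda>h. F' (p 1 s) (h *\<^sub>R (t *\<^sub>R v)) - F' (p 0 s) (h *\<^sub>R (t *\<^sub>R v))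
                 - h *\<^sub>R (t\<^sup>2 *\<^sub>R D u)) \<le> e * t\<^sup>2" if s: "s \<in> {0..1}" for s
    proof (rule onorm_le)
      fix h :: real
      have lin: "linear (F' (p a s))" if "a \<in> {0..1}" for a
        using pd(1)[OF s that] d1(2)[of "p a s"] has_derivative_linear by (auto simp: dist_norm)
      define N where "N a = F' (p a s) v - F' x v - D (p a s - x)" for a
      have N: "norm (N a) \<le> e / C * (t * (norm u + norm v))" if "a \<in> {0..1}" for a
      proof -
        have "norm (N a) \<le> e / C * norm (p a s - x)"
          unfolding N_def using pd(2)[OF s that] by (rule d2)
        also have "\<dots> \<le> e / C * (t * (norm u + norm v))"
          using pn[OF s that] e C by (intro mult_left_mono) auto
        finally show ?thesis .
      qed
      have "p 1 s - p 0 s = t *\<^sub>R u" unfolding p_def by simp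
      then have "D (p 1 s - x) - D (p 0 s - x) = t *\<^sub>R D u"
        using D.scaleR[of t u] by (simp flip: D.diff)
      then have "F' (p 1 s) v - F' (p 0 s) v - t *\<^sub>R D u = N 1 - N 0"
        unfolding N_def by (simp add: algebra_simps)
      then have "norm (F' (p 1 s) v - F' (p 0 s) v - t *\<^sub>R D u) \<le> norm (N 1) + norm (N 0)"
        by (simp add: norm_triangle_ineq4)
      also have "\<dots> \<le> e / C * (2 * (t * (norm u + norm v)))"
        unfolding mult.left_commute[of "e / C" 2] mult_2[of "e / C * (t * (norm u + norm v))"]
        by (intro add_mono N) auto
      also have "\<dots> \<le> e / C * (t * C)"
        using tn e C by (intro mult_left_mono) auto
      also have "\<dots> = e * t" using C by simp
      finally have b: "norm (F' (p 1 s) v - F' (p 0 s) v - t *\<^sub>R D u) \<le> e * t" .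
      have "F' (p 1 s) (h *\<^sub>R (t *\<^sub>R v)) - F' (p 0 s) (h *\<^sub>R (t *\<^sub>R v)) - h *\<^sub>R (t\<^sup>2 *\<^sub>R D u)
          = (h * t) *\<^sub>R (F' (p 1 s) v - F' (p 0 s) v - t *\<^sub>R D u)"
        using lin[of 0] lin[of 1] by (simp add: linear_scale algebra_simps power2_eq_square)
      then have "norm (F' (p 1 s) (h *\<^sub>R (t *\<^sub>R v)) - F' (p 0 s) (h *\<^sub>R (t *\<^sub>R v)) - h *\<^sub>R (t\<^sup>2 *\<^sub>R D u))
          = \<bar>h\<bar> * t * norm (F' (p 1 s) v - F' (p 0 s) v - t *\<^sub>R D u)"
        using t by (simp add: abs_mult)
      also have "\<dots> \<le> \<bar>h\<bar> * t * (e * t)" using b t by (intro mult_left_mono) auto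
      finally show "norm (F' (p 1 s) (h *\<^sub>R (t *\<^sub>R v)) - F' (p 0 s) (h *\<^sub>R (t *\<^sub>R v))
          - h *\<^sub>R (t\<^sup>2 *\<^sub>R D u)) \<le> e * t\<^sup>2 * norm h"
        by (simp add: power2_eq_square algebra_simps)
    qed
    have "norm (q 1 - q 0) \<le> e * t\<^sup>2 * norm (1 - 0 :: real)"
      by (rule differentiable_bound[OF _ q' bound]) auto
    moreover have "q 1 - q 0 = F (x + t *\<^sub>R u + t *\<^sub>R v) - F (x + t *\<^sub>R u) - F (x + t *\<^sub>R v) + F x
            - t\<^sup>2 *\<^sub>R D u"
      by (simp add: q_def p_def algebra_simps)
    ultimately show ?thesis by simp
  qed
  then show ?thesis
    unfolding eventually_at_right_field using d by blast
qed

text \<open>The second difference does not change when \<open>u\<close> and \<open>v\<close> are exchanged, so its two asymptotic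
expansions \<open>t\<^sup>2 Dv u\<close> and \<open>t\<^sup>2 Du v\<close> must agree.\<close>

lemma second_derivative_symmetric:
  fixes F :: "'v::euclidean_space \<Rightarrow> 'w::real_normed_vector"
  assumes F: "\<forall>\<^sub>F y in nhds x. (F has_derivative F' y) (at y)"
    and D: "((\<lambda>y. F' y v) has_derivative Dv) (at x)"
    and E: "((\<lambda>y. F' y u) has_derivative Du) (at x)"
  shows "Dv u = Du v"
proof (rule ccontr)
  assume ne: "Dv u \<noteq> Du v"
  define e where "e = norm (Dv u - Du v) / 3"
  have e: "e > 0" using ne by (simp add: e_def)
  have "\<forall>\<^sub>F t in at_right (0::real). False"
    using second_difference_estimate[OF F D e, of u] second_difference_estimate[OF F E e, of v]
      eventually_at_right_less[of 0]
  proof eventually_elim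
    case (elim t)
    let ?\<Delta> = "F (x + t *\<^sub>R u + t *\<^sub>R v) - F (x + t *\<^sub>R u) - F (x + t *\<^sub>R v) + F x"
    have "norm (?\<Delta> - t\<^sup>2 *\<^sub>R Du v) \<le> e * t\<^sup>2"
      using elim(2) by (simp add: algebra_simps)
    then have "norm ((?\<Delta> - t\<^sup>2 *\<^sub>R Du v) - (?\<Delta> - t\<^sup>2 *\<^sub>R Dv u)) \<le> e * t\<^sup>2 + e * t\<^sup>2"
      using elim(1) norm_triangle_ineq4[of "?\<Delta> - t\<^sup>2 *\<^sub>R Du v" "?\<Delta> - t\<^sup>2 *\<^sub>R Dv u"] by linarith
    moreover have "(?\<Delta> - t\<^sup>2 *\<^sub>R Du v) - (?\<Delta> - t\<^sup>2 *\<^sub>R Dv u) = t\<^sup>2 *\<^sub>R (Dv u - Du v)"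
      by (simp add: algebra_simps)
    ultimately have "t\<^sup>2 * norm (Dv u - Du v) \<le> t\<^sup>2 * (2 * e)"
      by (simp add: mult.commute mult.left_commute)
    then have "3 * e \<le> 2 * e" using elim(3) by (simp add: e_def)
    with e show False by simp
  qed
  then show False by simp
qed

section \<open>Holomorphic functions of several variables\<close>

definition complex_diff :: "(complex^'m::finite \<Rightarrow> complex) \<Rightarrow> complex^'m \<Rightarrow> bool" where
  "complex_diff F x \<longleftrightarrow> (\<exists>F'. (F has_derivative F') (at x) \<and> (\<forall>c v. F' (c *s v) = c * F' v))"

lemma complex_diffI:
  "(F has_derivative F') (at x) \<Longrightarrow> (\<And>c v. F' (c *s v) = c * F' v) \<Longrightarrow> complex_diff F x"
  unfolding complex_diff_def by blast

lemma complex_diffD: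
  assumes "complex_diff F x"
  shows "(F has_derivative frechet_derivative F (at x)) (at x)"
    and "frechet_derivative F (at x) (c *s v) = c * frechet_derivative F (at x) v"
proof -
  obtain F' where F': "(F has_derivative F') (at x)" "\<And>c v. F' (c *s v) = c * F' v"
    using assms unfolding complex_diff_def by blast
  have "F' = frechet_derivative F (at x)" using F'(1) by (rule frechet_derivative_at)
  with F' show "(F has_derivative frechet_derivative F (at x)) (at x)"
    "frechet_derivative F (at x) (c *s v) = c * frechet_derivative F (at x) v" by auto
qed

lemma complex_diff_const: "complex_diff (\<lambda>y. c) x"
  by (rule complex_diffI[OF has_derivative_const]) simp

lemma complex_diff_add:
  assumes "complex_diff F x" "complex_diff G x"
  shows "complex_diff (\<lambda>y. F y + G y) x"
  by (rule complex_diffI[OF has_derivative_add[OF assms[THEN complex_diffD(1)]]])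
     (simp add: assms[THEN complex_diffD(2)] distrib_left)

lemma complex_diff_mult:
  assumes "complex_diff F x" "complex_diff G x"
  shows "complex_diff (\<lambda>y. F y * G y) x"
  by (rule complex_diffI[OF has_derivative_mult[OF assms[THEN complex_diffD(1)]]])
     (simp add: assms[THEN complex_diffD(2)] algebra_simps)

lemma complex_diff_sum:
  assumes "\<And>i. i \<in> I \<Longrightarrow> complex_diff (F i) x"
  shows "complex_diff (\<lambda>y. \<Sum>i\<in>I. F i y) x"
  using assms
  by (induction I rule: infinite_finite_induct) (auto intro!: complex_diff_add complex_diff_const)

lemma complex_diff_linear:
  assumes "bounded_linear L" "\<And>c v. L (c *s v) = c * L v"
  shows "complex_diff L x"
  by (rule complex_diffI[OF bounded_linear_imp_has_derivative[OF assms(1)] assms(2)])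

lemma complex_diff_compose_linear:
  assumes F: "complex_diff F (P x)" and P: "bounded_linear P" "\<And>c v. P (c *s v) = c *s P v"
  shows "complex_diff (\<lambda>y. F (P y)) x"
  by (rule complex_diffI[OF has_derivative_compose[OF bounded_linear_imp_has_derivative[OF P(1)]
        complex_diffD(1)[OF F]]]) (simp add: P(2) complex_diffD(2)[OF F])

lemma norm_smult_vec: "norm (c *s (v :: complex^'m::finite)) = cmod c * norm v"
  by (simp add: norm_vec_def norm_mult L2_set_right_distrib)

lemma bounded_linear_smult_left: "bounded_linear (\<lambda>t::complex. t *s (v :: complex^'m::finite))"
  by (rule bounded_linear_intro[where K = "norm v"])
     (auto simp: norm_smult_vec vec_eq_iff algebra_simps)

text \<open>Cauchy's formula for the derivative at \<open>0\<close> of the function \<open>t \<mapsto> F (y + t v)\<close> of one variable.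
It expresses a derivative of \<open>F\<close> by values of \<open>F\<close> alone, along a contour that does not move with \<open>y\<close>;
both lemmas on directional derivatives below rest on this.\<close>

lemma directional_derivative_circle_integral:
  fixes F :: "complex^'m::finite \<Rightarrow> complex"
  assumes hol: "\<And>t. t \<in> cball 0 r \<Longrightarrow> complex_diff F (y + t *s v)" and r: "r > 0"
  shows "frechet_derivative F (at y) v =
    integral (cbox 0 1) (\<lambda>s. F (y + (r * exp (2 * of_real pi * \<i> * of_real s)) *s v)
                          * (exp (- (2 * of_real pi * \<i> * of_real s)) / r))"
proof -
  define g where "g t = F (y + t *s v)" for t
  have der: "(g has_field_derivative frechet_derivative F (at (y + t *s v)) v) (at t)"
    if "t \<in> cball 0 r" for t
  proof -
    have 1: "((\<lambda>t. y + t *s v) has_derivative (\<lambda>h. h *s v)) (at t)"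
      using bounded_linear_imp_has_derivative[OF bounded_linear_smult_left]
      by (auto intro!: derivative_eq_intros)
    have "(g has_derivative (\<lambda>h. frechet_derivative F (at (y + t *s v)) (h *s v))) (at t)"
      unfolding g_def using has_derivative_compose[OF 1 complex_diffD(1)[OF hol[OF that]]] .
    then show ?thesis
      unfolding has_field_derivative_def
      by (rule has_derivative_eq_rhs) (simp add: fun_eq_iff complex_diffD(2)[OF hol[OF that]])
  qed
  have "continuous_on (cball 0 r) g"
    using der by (meson DERIV_continuous_on has_field_derivative_at_within)
  moreover have "g holomorphic_on ball 0 r"
    by (rule holomorphic_onI) (meson ball_subset_cball der field_differentiable_at_within
        field_differentiable_def subsetD)
  ultimately have "(g has_field_derivative
      (1 / (2 * of_real pi * \<i>) * contour_integral (circlepath 0 r) (\<lambda>u. g u / (u - 0)^2))) (at 0)"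
    using r by (intro Cauchy_derivative_integral_circlepath) auto
  with der[of 0] r have "frechet_derivative F (at y) v =
      1 / (2 * of_real pi * \<i>) * contour_integral (circlepath 0 r) (\<lambda>u. g u / u^2)"
    by (auto dest: DERIV_unique)
  also have "\<dots> = integral {0..1} (\<lambda>s. 1 / (2 * of_real pi * \<i>) *
      (g (circlepath 0 r s) / (circlepath 0 r s)^2 * vector_derivative (circlepath 0 r) (at s)))"
    by (simp only: contour_integral_integral integral_mult_right)
  also have "\<dots> = integral {0..1} (\<lambda>s. F (y + (r * exp (2 * of_real pi * \<i> * of_real s)) *s v)
                          * (exp (- (2 * of_real pi * \<i> * of_real s)) / r))"
  proof (rule integral_cong)
    fix s :: real
    define E where "E = exp (2 * of_real pi * \<i> * complex_of_real s)"
    have "E \<noteq> 0" "exp (- (2 * of_real pi * \<i> * complex_of_real s)) = inverse E"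
      by (auto simp: E_def exp_minus)
    then show "1 / (2 * of_real pi * \<i>) *
      (g (circlepath 0 r s) / (circlepath 0 r s)^2 * vector_derivative (circlepath 0 r) (at s)) =
        F (y + (r * exp (2 * of_real pi * \<i> * of_real s)) *s v)
                          * (exp (- (2 * of_real pi * \<i> * of_real s)) / r)"
      using r unfolding g_def vector_derivative_circlepath unfolding circlepath E_def[symmetric]
      by (simp add: power2_eq_square) (simp add: divide_simps)
  qed
  finally show ?thesis by simp
qed

text \<open>One radius serves for all centres near \<open>x\<close>, so that the circle integral can be treated as an
integral depending on the parameter \<open>y\<close>.\<close>

lemma circle_in_open:
  fixes S :: "(complex^'m::finite) set"
  assumes "open S" "x \<in> S"
  obtains \<delta> r where "\<delta> > 0" "r > 0" "\<And>y t. y \<in> ball x \<delta> \<Longrightarrow> t \<in> cball 0 r \<Longrightarrow> y + t *s v \<in> S"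
proof -
  obtain e where e: "e > 0" "ball x e \<subseteq> S" using assms open_contains_ball by blast
  define r where "r = e / (2 * (norm v + 1))"
  have v: "norm v + 1 > 0" by (simp add: add_nonneg_pos)
  have "r > 0" using e v by (simp add: r_def)
  moreover have "y + t *s v \<in> S" if "y \<in> ball x (e/2)" "t \<in> cball 0 r" for y t
  proof -
    have "norm (t *s v) \<le> r * norm v"
      using that by (auto simp: norm_smult_vec intro!: mult_right_mono)
    also have "\<dots> < r * (norm v + 1)" using \<open>r > 0\<close> by simp
    also have "\<dots> = e / 2" using v by (simp add: r_def divide_simps)
    finally have "norm (t *s v) < e / 2" .
    moreover have "norm (y - x) < e / 2" using that by (simp add: dist_norm norm_minus_commute)
    ultimately have "norm ((y - x) + t *s v) < e" using norm_triangle_lt[of "y - x" "t *s v" e] by simp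
    then have "y + t *s v \<in> ball x e" by (simp add: dist_norm norm_minus_commute algebra_simps)
    then show ?thesis using e by blast
  qed
  ultimately show ?thesis using that[of "e/2" r] e by simp
qed

text \<open>The integrand in Cauchy's formula is continuous in the parameter, hence so is the integral.\<close>

lemma continuous_on_directional_derivative:
  fixes F :: "complex^'m::finite \<Rightarrow> complex"
  assumes S: "open S" and F: "\<And>y. y \<in> S \<Longrightarrow> complex_diff F y"
  shows "continuous_on S (\<lambda>y. frechet_derivative F (at y) v)"
proof -
  have cF: "continuous_on S F"
    by (rule has_derivative_continuous_on, rule has_derivative_at_withinI, rule complex_diffD(1)[OF F])
  have "isCont (\<lambda>y. frechet_derivative F (at y) v) x" if "x \<in> S" for x
  proof -
    obtain d r where dr: "d > 0" "r > 0" "\<And>y t. y \<in> ball x d \<Longrightarrow> t \<in> cball 0 r \<Longrightarrow> y + t *s v \<in> S"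
      using circle_in_open[OF S \<open>x \<in> S\<close>] by metis
    have "continuous_on (ball x d) (\<lambda>y. integral (cbox 0 1)
        (\<lambda>s. F (y + (r * exp (2 * of_real pi * \<i> * of_real s)) *s v)
                          * (exp (- (2 * of_real pi * \<i> * of_real s)) / r)))"
      using dr by (intro integral_continuous_on_param)
        (auto simp: case_prod_unfold norm_mult intro!: continuous_intros continuous_on_compose2[OF cF]
           bounded_linear.continuous_on[OF bounded_linear_smult_left])
    then have "continuous_on (ball x d) (\<lambda>y. frechet_derivative F (at y) v)"
      using dr F by (subst continuous_on_cong[OF refl directional_derivative_circle_integral[of r]]) auto
    then show ?thesis using dr(1) by (simp add: continuous_on_eq_continuous_at)
  qed
  then show ?thesis by (simp add: continuous_at_imp_continuous_on)
qed

text \<open>Differentiation under the integral sign in Cauchy's formula. The derivative of the integrand is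
jointly continuous by the preceding lemma, and complex linearity passes through the integral.\<close>

lemma complex_diff_directional_derivative:
  fixes F :: "complex^'m::finite \<Rightarrow> complex"
  assumes S: "open S" "x \<in> S" and F: "\<And>y. y \<in> S \<Longrightarrow> complex_diff F y"
  shows "complex_diff (\<lambda>y. frechet_derivative F (at y) v) x"
proof -
  have cF: "continuous_on S F"
    by (rule has_derivative_continuous_on, rule has_derivative_at_withinI, rule complex_diffD(1)[OF F])
  obtain d r where dr: "d > 0" "r > 0" "\<And>y t. y \<in> ball x d \<Longrightarrow> t \<in> cball 0 r \<Longrightarrow> y + t *s v \<in> S"
    using circle_in_open[OF S] by metis
  define p where "p y s = y + (complex_of_real r * exp (2 * of_real pi * \<i> * complex_of_real s)) *s v" for y s
  define k where "k s = exp (- (2 * of_real pi * \<i> * complex_of_real s)) / r" for s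
  define F' where "F' y = frechet_derivative F (at y)" for y
  have pS: "p y s \<in> S" if "y \<in> ball x d" for y s
    unfolding p_def using that dr by (intro dr) (auto simp: norm_mult)
  have bl: "bounded_linear (\<lambda>w. F' (p y s) w * k s)" if "y \<in> ball x d" for y s
    using complex_diffD(1)[OF F[OF pS[OF that]]] has_derivative_bounded_linear
    unfolding F'_def by (intro bounded_linear_mult_const) blast
  define fx where "fx y s = Blinfun (\<lambda>w. F' (p y s) w * k s)" for y s
  have fx: "blinfun_apply (fx y s) = (\<lambda>w. F' (p y s) w * k s)" if "y \<in> ball x d" for y s
    unfolding fx_def using bl[OF that] by (rule bounded_linear_Blinfun_apply)
  have cp: "continuous_on X (\<lambda>z. p (fst z) (snd z))" for X
    unfolding p_def by (intro continuous_intros bounded_linear.continuous_on[OF bounded_linear_smult_left])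
  have ck: "continuous_on X (\<lambda>z. k (snd z))" for X :: "((complex^'m) \<times> real) set"
    unfolding k_def using dr by (intro continuous_intros) auto
  have cfx: "continuous_on (ball x d \<times> cbox 0 1) (\<lambda>(y, s). fx y s)"
  proof (rule continuous_on_blinfun_componentwise)
    fix b :: "complex^'m"
    have "continuous_on (ball x d \<times> cbox 0 1) (\<lambda>z. F' (p (fst z) (snd z)) b * k (snd z))"
      unfolding F'_def
      by (intro continuous_intros ck
          continuous_on_compose2[OF continuous_on_directional_derivative[OF S(1) F] cp])
         (auto intro!: pS)
    then show "continuous_on (ball x d \<times> cbox 0 1) (\<lambda>z. blinfun_apply (case z of (y, s) \<Rightarrow> fx y s) b)"
      by (rule continuous_on_eq) (auto simp: fx)
  qed
  have xd: "x \<in> ball x d" using dr by simp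
  have "((\<lambda>y. integral (cbox 0 1) (\<lambda>s. F (p y s) * k s)) has_derivative
      integral (cbox 0 1) (fx x)) (at x within ball x d)"
  proof (rule leibniz_rule[OF _ _ cfx xd convex_ball])
    fix y s assume y: "y \<in> ball x d"
    have "((\<lambda>y. F (p y s)) has_derivative (\<lambda>w. F' (p y s) w)) (at y within ball x d)"
    proof (rule has_derivative_compose[where g = F])
      show "((\<lambda>y. p y s) has_derivative (\<lambda>w. w)) (at y within ball x d)"
        unfolding p_def by (auto intro!: derivative_eq_intros)
      show "(F has_derivative F' (p y s)) (at (p y s))"
        unfolding F'_def by (rule complex_diffD(1)[OF F[OF pS[OF y]]])
    qed
    then show "((\<lambda>y. F (p y s) * k s) has_derivative blinfun_apply (fx y s)) (at y within ball x d)"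
      unfolding fx[OF y] by (rule has_derivative_mult_left)
  next
    fix y assume y: "y \<in> ball x d"
    have "continuous_on (cbox 0 1) (\<lambda>s. F (p y s) * k s)"
      unfolding p_def k_def using pS[OF y] dr(2)
      by (intro continuous_intros continuous_on_compose2[OF cF]
          bounded_linear.continuous_on[OF bounded_linear_smult_left]) (auto simp: p_def)
    then show "(\<lambda>s. F (p y s) * k s) integrable_on cbox 0 1" by (rule integrable_continuous)
  qed
  then have "((\<lambda>y. integral (cbox 0 1) (\<lambda>s. F (p y s) * k s)) has_derivative
      integral (cbox 0 1) (fx x)) (at x)"
    using at_within_open[OF xd open_ball] by simp
  then have der: "((\<lambda>y. frechet_derivative F (at y) v) has_derivative integral (cbox 0 1) (fx x)) (at x)"
  proof (rule has_derivative_transform_within_open[OF _ open_ball xd])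
    fix y assume "y \<in> ball x d"
    then show "integral (cbox 0 1) (\<lambda>s. F (p y s) * k s) = frechet_derivative F (at y) v"
      unfolding p_def k_def
      by (intro directional_derivative_circle_integral[symmetric] F dr)
  qed
  have int: "fx x integrable_on cbox 0 1"
  proof (rule integrable_continuous)
    show "continuous_on (cbox 0 1) (fx x)"
    proof -
      have "continuous_on (cbox 0 1) (\<lambda>s::real. (x, s))" by (intro continuous_intros)
      moreover have "(\<lambda>s. (x, s)) ` cbox 0 (1::real) \<subseteq> ball x d \<times> cbox 0 1" using xd by auto
      ultimately show ?thesis
        using continuous_on_compose2[OF cfx, of "cbox 0 1" "\<lambda>s. (x, s)"] by simp
    qed
  qed
  have app: "blinfun_apply (integral (cbox 0 1) (fx x)) w = integral (cbox 0 1) (\<lambda>s. F' (p x s) w * k s)" for w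
    using blinfun_apply_integral[OF int, of w] by (simp add: fx[OF xd])
  show ?thesis
  proof (rule complex_diffI[OF der])
    fix c w
    have "F' (p x s) (c *s w) = c * F' (p x s) w" for s
      unfolding F'_def by (rule complex_diffD(2)[OF F[OF pS[OF xd]]])
    then show "blinfun_apply (integral (cbox 0 1) (fx x)) (c *s w) =
        c * blinfun_apply (integral (cbox 0 1) (fx x)) w"
      unfolding app by (simp add: mult.assoc)
  qed
qed

lemma twice_diff_if_complex_diff:
  fixes F :: "complex^'m::finite \<Rightarrow> complex"
  assumes S: "open S" "x \<in> S" and F: "\<And>y. y \<in> S \<Longrightarrow> complex_diff F y"
  shows "twice_diff F x"
proof (rule twice_diffI)
  show "\<forall>\<^sub>F y in nhds x. (F has_derivative frechet_derivative F (at y)) (at y)"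
    unfolding eventually_nhds using S complex_diffD(1)[OF F] by blast
  show "(\<lambda>y. frechet_derivative F (at y) v) differentiable at x" for v
    using complex_diffD(1)[OF complex_diff_directional_derivative[OF S F]] differentiable_def by blast
qed

lemma twice_diff_vec:
  fixes F :: "'v::euclidean_space \<Rightarrow> complex^'n::finite"
  assumes "\<And>i. twice_diff (\<lambda>y. F y $ i) x"
  shows "twice_diff F x"
proof -
  have "twice_diff (\<lambda>y. \<Sum>i\<in>UNIV. F y $ i *s axis i 1) x"
    by (intro twice_diff_sum twice_diff_bounded_linear[OF bounded_linear_smult_left] assms)
  then show ?thesis by (simp add: basis_expansion)
qed

section \<open>Wirtinger derivatives\<close>

text \<open>The two values \<open>\<kappa> = - \<i>\<close> and \<open>\<kappa> = \<i>\<close> give \<open>\<partial>/\<partial>z\<^sup>a\<close> and its conjugate; a general factor lets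
one lemma serve for both operators.\<close>

definition wirtinger :: "complex \<Rightarrow> 'd::finite \<Rightarrow> (complex^'d \<Rightarrow> complex) \<Rightarrow> complex^'d \<Rightarrow> complex" where
  "wirtinger \<kappa> a F x = (frechet_derivative F (at x) (axis a 1)
                 + \<kappa> * frechet_derivative F (at x) (axis a \<i>)) / 2"

lemma wirt_eq_wirtinger: "wirt a = wirtinger (- \<i>) a"
  by (simp add: wirt_def wirtinger_def fun_eq_iff)

lemma wirt_bar_eq_wirtinger: "wirt_bar a = wirtinger \<i> a"
  by (simp add: wirt_bar_def wirtinger_def fun_eq_iff)

lemma wirtinger_has_derivative:
  "(F has_derivative F') (at x) \<Longrightarrow> wirtinger \<kappa> a F x = (F' (axis a 1) + \<kappa> * F' (axis a \<i>)) / 2"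
  unfolding wirtinger_def by (metis frechet_derivative_at)

lemma wirtinger_cong:
  assumes "\<forall>\<^sub>F y in nhds x. F y = G y"
  shows "wirtinger \<kappa> a F x = wirtinger \<kappa> a G x"
proof -
  have "\<forall>\<^sub>F y in nhds x. G y = F y" using assms by (rule eventually_mono) simp
  then have "(F has_derivative F') (at x) \<longleftrightarrow> (G has_derivative F') (at x)" for F'
    using assms has_derivative_cong_nhds by blast
  then show ?thesis unfolding wirtinger_def frechet_derivative_def by simp
qed

lemma wirtinger_cong_eventually:
  assumes "\<forall>\<^sub>F y in nhds x. F y = G y"
  shows "\<forall>\<^sub>F y in nhds x. wirtinger \<kappa> a F y = wirtinger \<kappa> a G y"
proof -
  have "\<forall>\<^sub>F y in nhds x. \<forall>\<^sub>F z in nhds y. F z = G z"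
    using assms by (simp add: eventually_eventually)
  then show ?thesis by (rule eventually_mono) (rule wirtinger_cong)
qed

lemma wirtinger_const [simp]: "wirtinger \<kappa> a (\<lambda>y. c) x = 0"
  by (simp add: wirtinger_has_derivative[OF has_derivative_const])

lemma wirtinger_add:
  assumes "F differentiable at x" "G differentiable at x"
  shows "wirtinger \<kappa> a (\<lambda>y. F y + G y) x = wirtinger \<kappa> a F x + wirtinger \<kappa> a G x"
proof -
  obtain F' G' where "(F has_derivative F') (at x)" "(G has_derivative G') (at x)"
    using assms unfolding differentiable_def by blast
  then show ?thesis
    by (simp add: wirtinger_has_derivative[OF has_derivative_add] wirtinger_has_derivative field_simps)
qed

lemma wirtinger_minus:
  assumes "F differentiable at x"
  shows "wirtinger \<kappa> a (\<lambda>y. - F y) x = - wirtinger \<kappa> a F x"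
proof -
  obtain F' where "(F has_derivative F') (at x)"
    using assms unfolding differentiable_def by blast
  then show ?thesis
    by (simp add: wirtinger_has_derivative[OF has_derivative_minus] wirtinger_has_derivative field_simps)
qed

lemma wirtinger_diff:
  assumes "F differentiable at x" "G differentiable at x"
  shows "wirtinger \<kappa> a (\<lambda>y. F y - G y) x = wirtinger \<kappa> a F x - wirtinger \<kappa> a G x"
  using wirtinger_add[OF assms(1) differentiable_minus[OF assms(2)]] wirtinger_minus[OF assms(2)]
  by simp

lemma wirtinger_mult:
  assumes "F differentiable at x" "G differentiable at x"
  shows "wirtinger \<kappa> a (\<lambda>y. F y * G y) x = wirtinger \<kappa> a F x * G x + F x * wirtinger \<kappa> a G x"
proof -
  obtain F' G' where "(F has_derivative F') (at x)" "(G has_derivative G') (at x)"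
    using assms unfolding differentiable_def by blast
  then show ?thesis
    by (simp add: wirtinger_has_derivative[OF has_derivative_mult] wirtinger_has_derivative field_simps)
qed

lemma wirtinger_sum:
  assumes "\<And>i. i \<in> I \<Longrightarrow> F i differentiable at x"
  shows "wirtinger \<kappa> a (\<lambda>y. \<Sum>i\<in>I. F i y) x = (\<Sum>i\<in>I. wirtinger \<kappa> a (F i) x)"
  using assms
proof (induction I rule: infinite_finite_induct)
  case (insert i I)
  have "(\<lambda>y. \<Sum>i\<in>I. F i y) differentiable at x"
    using insert by (intro differentiable_sum) auto
  with insert show ?case by (simp add: wirtinger_add)
qed auto

lemma wirtinger_inverse:
  assumes "F differentiable at x" "F x \<noteq> 0"
  shows "wirtinger \<kappa> a (\<lambda>y. inverse (F y)) x = - wirtinger \<kappa> a F x / (F x)\<^sup>2"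
proof -
  obtain F' where F': "(F has_derivative F') (at x)"
    using assms unfolding differentiable_def by blast
  show ?thesis
    using assms(2)
    unfolding wirtinger_has_derivative[OF F']
      wirtinger_has_derivative[OF Deriv.has_derivative_inverse[OF assms(2) F']]
    by (simp add: field_simps power2_eq_square)
qed

lemma wirtinger_ln_inverse:
  assumes "F differentiable at x" "F x \<in> \<real>" "Re (F x) > 0"
  shows "wirtinger \<kappa> a (\<lambda>y. ln (inverse (F y))) x = - wirtinger \<kappa> a F x / F x"
proof -
  obtain F' where F': "(F has_derivative F') (at x)"
    using assms unfolding differentiable_def by blast
  have F0: "F x \<noteq> 0" using assms by auto
  obtain r where r: "F x = of_real r" "r > 0"
    using assms(2,3) by (auto elim!: Reals_cases)
  have "inverse (F x) \<notin> \<real>\<^sub>\<le>\<^sub>0"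
    using r by (simp flip: of_real_inverse)
  then have "((\<lambda>y. ln (inverse (F y))) has_derivative
      (\<lambda>v. inverse (inverse (F x)) * (- (inverse (F x) * F' v * inverse (F x))))) (at x)"
    using has_derivative_compose[OF Deriv.has_derivative_inverse[OF F0 F']
        has_field_derivative_Ln[THEN has_field_derivative_imp_has_derivative]]
    by simp
  with F' F0 show ?thesis
    by (simp add: wirtinger_has_derivative field_simps)
qed

lemma cnj_wirtinger:
  assumes "F differentiable at x"
  shows "cnj (wirtinger \<kappa> a F x) = wirtinger (cnj \<kappa>) a (\<lambda>y. cnj (F y)) x"
proof -
  obtain F' where F': "(F has_derivative F') (at x)"
    using assms unfolding differentiable_def by blast
  show ?thesis
    by (simp add: wirtinger_has_derivative[OF has_derivative_cnj[OF F']] wirtinger_has_derivative[OF F'])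
qed

lemma differentiable_cnj:
  "F differentiable at x \<Longrightarrow> (\<lambda>y. cnj (F y)) differentiable at x"
  unfolding differentiable_def by (blast intro: has_derivative_cnj)

lemma wirtinger_compose_linear:
  assumes F: "F differentiable at (P x)" and P: "bounded_linear P"
    and b: "P (axis a 1) = axis b 1" "P (axis a \<i>) = axis b \<i>"
  shows "wirtinger \<kappa> a (\<lambda>y. F (P y)) x = wirtinger \<kappa> b F (P x)"
proof -
  obtain F' where F': "(F has_derivative F') (at (P x))"
    using F unfolding differentiable_def by blast
  show ?thesis
    unfolding wirtinger_has_derivative[OF F'] b
      wirtinger_has_derivative[OF has_derivative_compose[OF bounded_linear_imp_has_derivative[OF P] F']] ..
qed

lemma wirtinger_compose_linear_0:
  assumes F: "F differentiable at (P x)" and P: "bounded_linear P"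
    and b: "P (axis a 1) = 0" "P (axis a \<i>) = 0"
  shows "wirtinger \<kappa> a (\<lambda>y. F (P y)) x = 0"
proof -
  obtain F' where F': "(F has_derivative F') (at (P x))"
    using F unfolding differentiable_def by blast
  show ?thesis
    unfolding b
      wirtinger_has_derivative[OF has_derivative_compose[OF bounded_linear_imp_has_derivative[OF P] F']]
    using linear_0[OF has_derivative_linear[OF F']] by simp
qed

lemma twice_diff_wirtinger_differentiable:
  assumes "twice_diff F x"
  shows "wirtinger \<kappa> a F differentiable at x"
proof -
  obtain F' where F': "\<forall>\<^sub>F y in nhds x. (F has_derivative F' y) (at y)"
      "\<And>v. (\<lambda>y. F' y v) differentiable (at x)"
    using assms unfolding twice_diff_def by blast
  have ev: "\<forall>\<^sub>F y in nhds x. (F' y (axis a 1) + \<kappa> * F' y (axis a \<i>)) / 2 = wirtinger \<kappa> a F y"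
    using F'(1) by (rule eventually_mono) (simp add: wirtinger_has_derivative)
  have "(\<lambda>y. (F' y (axis a 1) + \<kappa> * F' y (axis a \<i>)) * (1/2)) differentiable at x"
    by (intro differentiable_add differentiable_mult differentiable_const F')
  then obtain D where "((\<lambda>y. (F' y (axis a 1) + \<kappa> * F' y (axis a \<i>)) / 2) has_derivative D) (at x)"
    by (auto simp: differentiable_def)
  then have "(wirtinger \<kappa> a F has_derivative D) (at x)"
    using ev by (rule has_derivative_cong_nhds)
  then show ?thesis unfolding differentiable_def by blast
qed

text \<open>Both sides are the same combination of values of the symmetric second derivative of \<open>F\<close>.\<close>

lemma wirtinger_commute:
  assumes "twice_diff F x"
  shows "wirtinger \<kappa> a (wirtinger \<mu> b F) x = wirtinger \<mu> b (wirtinger \<kappa> a F) x"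
proof -
  obtain F' where F': "\<forall>\<^sub>F y in nhds x. (F has_derivative F' y) (at y)"
      "\<And>v. (\<lambda>y. F' y v) differentiable (at x)"
    using assms unfolding twice_diff_def by blast
  obtain D where D: "\<And>v. ((\<lambda>y. F' y v) has_derivative D v) (at x)"
    using F'(2) unfolding differentiable_def by metis
  have sym: "D v u = D u v" for u v
    by (rule second_derivative_symmetric[OF F'(1) D D])
  have second: "wirtinger \<kappa> a (wirtinger \<mu> b F) x =
      ((D (axis b 1) (axis a 1) + \<mu> * D (axis b \<i>) (axis a 1)) / 2 +
       \<kappa> * ((D (axis b 1) (axis a \<i>) + \<mu> * D (axis b \<i>) (axis a \<i>)) / 2)) / 2" for \<kappa> \<mu> a b
  proof -
    have ev: "\<forall>\<^sub>F y in nhds x. wirtinger \<mu> b F y = (F' y (axis b 1) + \<mu> * F' y (axis b \<i>)) / 2"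
      using F'(1) by (rule eventually_mono) (simp add: wirtinger_has_derivative)
    have "((\<lambda>y. (F' y (axis b 1) + \<mu> * F' y (axis b \<i>)) / 2) has_derivative
        (\<lambda>v. (D (axis b 1) v + \<mu> * D (axis b \<i>) v) / 2)) (at x)"
      by (auto intro!: derivative_eq_intros D)
    from wirtinger_has_derivative[OF this] show ?thesis
      by (simp add: wirtinger_cong[OF ev])
  qed
  have swap: "D (axis b s) (axis a t) = D (axis a t) (axis b s)" for s t by (rule sym)
  show ?thesis
    unfolding second[of \<kappa> a \<mu> b] second[of \<mu> b \<kappa> a] swap by (simp add: field_simps)
qed

text \<open>Conjugation exchanges the two kinds of Wirtinger derivatives of a real function, and these commute.\<close>

lemma hermitian_second_derivatives:
  assumes F: "twice_diff F x" and real: "\<forall>\<^sub>F y in nhds x. F y \<in> \<real>"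
  shows "wirt a (wirt_bar b F) x = cnj (wirt b (wirt_bar a F) x)"
proof -
  have "\<forall>\<^sub>F y in nhds x. cnj (wirtinger \<i> a F y) = wirtinger (-\<i>) a F y"
  proof -
    have "\<forall>\<^sub>F y in nhds x. wirtinger (-\<i>) a (\<lambda>y. cnj (F y)) y = wirtinger (-\<i>) a F y"
      using real by (intro wirtinger_cong_eventually) (auto simp: Reals_cnj_iff elim: eventually_mono)
    then show ?thesis
      using twice_diff_eventually_differentiable[OF F]
      by eventually_elim (simp add: cnj_wirtinger)
  qed
  then have "cnj (wirtinger (-\<i>) b (wirtinger \<i> a F) x) = wirtinger \<i> b (wirtinger (-\<i>) a F) x"
    using twice_diff_wirtinger_differentiable[OF F] by (simp add: cnj_wirtinger wirtinger_cong)
  also have "\<dots> = wirtinger (-\<i>) a (wirtinger \<i> b F) x" by (rule wirtinger_commute[OF F])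
  finally show ?thesis by (simp add: wirt_eq_wirtinger wirt_bar_eq_wirtinger)
qed

lemma wirt_bar_complex_diff:
  assumes "complex_diff F x" shows "wirtinger \<i> a F x = 0"
proof -
  have ax: "axis a \<i> = \<i> *s axis a 1" by (simp add: vec_eq_iff axis_def)
  show ?thesis
    using complex_diffD(2)[OF assms, of \<i> "axis a 1"] unfolding wirtinger_def ax
    by (simp add: algebra_simps flip: mult.assoc)
qed

lemma wirt_complex_diff:
  assumes "complex_diff F x" shows "wirtinger (-\<i>) a F x = frechet_derivative F (at x) (axis a 1)"
proof -
  have ax: "axis a \<i> = \<i> *s axis a 1" by (simp add: vec_eq_iff axis_def)
  show ?thesis
    using complex_diffD(2)[OF assms, of \<i> "axis a 1"] unfolding wirtinger_def ax
    by (simp add: algebra_simps flip: mult.assoc)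
qed

lemma complex_diff_wirt:
  fixes F :: "complex^'m::finite \<Rightarrow> complex"
  assumes S: "open S" "x \<in> S" and F: "\<And>y. y \<in> S \<Longrightarrow> complex_diff F y"
  shows "complex_diff (wirt a F) x"
proof -
  have D: "complex_diff (\<lambda>y. frechet_derivative F (at y) (axis a 1)) x"
    by (rule complex_diff_directional_derivative[OF S F])
  have "frechet_derivative F (at y) (axis a 1) = wirt a F y" if "y \<in> S" for y
    unfolding wirt_eq_wirtinger by (rule wirt_complex_diff[OF F[OF that], symmetric])
  then have "(wirt a F has_derivative
      frechet_derivative (\<lambda>y. frechet_derivative F (at y) (axis a 1)) (at x)) (at x)"
    by (rule has_derivative_transform_within_open[OF complex_diffD(1)[OF D] S])
  then show ?thesis by (rule complex_diffI) (rule complex_diffD(2)[OF D])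
qed

section \<open>Hermitian forms and matrix-valued functions\<close>

text \<open>With row vectors, \<open>dotc (u v* A) w\<close> is the sesquilinear form \<open>u A w\<^sup>*\<close>. Writing it in this way lets
matrix identities replace manipulations of double sums.\<close>

definition dotc :: "complex^'n::finite \<Rightarrow> complex^'n \<Rightarrow> complex" where
  "dotc p w = (\<Sum>i\<in>UNIV. p $ i * cnj (w $ i))"

definition adjoint_mat :: "complex^'n::finite^'m::finite \<Rightarrow> complex^'m^'n" where
  "adjoint_mat A = (\<chi> i j. cnj (A $ j $ i))"

lemma dotc_add_left: "dotc (p + q) w = dotc p w + dotc q w"
  by (simp add: dotc_def algebra_simps sum.distrib)
lemma dotc_add_right: "dotc p (v + w) = dotc p v + dotc p w"
  by (simp add: dotc_def algebra_simps sum.distrib)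
lemma dotc_diff_left: "dotc (p - q) w = dotc p w - dotc q w"
  by (simp add: dotc_def algebra_simps sum_subtractf)
lemma dotc_diff_right: "dotc p (v - w) = dotc p v - dotc p w"
  by (simp add: dotc_def algebra_simps sum_subtractf)
lemma dotc_minus_left: "dotc (- p) w = - dotc p w"
  by (simp add: dotc_def sum_negf)
lemma dotc_smult_left: "dotc (c *s p) w = c * dotc p w"
  by (simp add: dotc_def sum_distrib_left mult.assoc)
lemma dotc_smult_right: "dotc p (c *s w) = cnj c * dotc p w"
  by (simp add: dotc_def sum_distrib_left mult_ac)
lemma dotc_zero [simp]: "dotc 0 w = 0" "dotc p 0 = 0"
  by (simp_all add: dotc_def)
lemma dotc_sum_left: "dotc (\<Sum>i\<in>I. p i) w = (\<Sum>i\<in>I. dotc (p i) w)"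
  by (induction I rule: infinite_finite_induct) (auto simp: dotc_add_left)
lemma dotc_sum_right: "dotc p (\<Sum>i\<in>I. w i) = (\<Sum>i\<in>I. dotc p (w i))"
  by (induction I rule: infinite_finite_induct) (auto simp: dotc_add_right)

lemma cnj_dotc: "cnj (dotc p w) = dotc w p"
  by (simp add: dotc_def mult.commute)

lemma dotc_matrix: "dotc (u v* A) w = (\<Sum>i\<in>UNIV. \<Sum>j\<in>UNIV. A $ i $ j * u $ i * cnj (w $ j))"
  unfolding dotc_def vector_matrix_mult_def
  by (subst sum.swap) (simp add: sum_distrib_right sum_distrib_left mult_ac)

lemma dotc_adjoint: "dotc u (w v* A) = dotc (u v* adjoint_mat A) w"
proof -
  have "dotc u (w v* A) = cnj (dotc (w v* A) u)" by (simp add: cnj_dotc)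
  also have "\<dots> = (\<Sum>i\<in>UNIV. \<Sum>j\<in>UNIV. cnj (A $ i $ j) * u $ j * cnj (w $ i))"
    by (simp add: dotc_matrix mult_ac)
  also have "\<dots> = dotc (u v* adjoint_mat A) w"
    unfolding dotc_matrix adjoint_mat_def by (subst sum.swap) simp
  finally show ?thesis .
qed

lemma adjoint_mat_mult: "adjoint_mat (A ** B) = adjoint_mat B ** adjoint_mat A"
  by (simp add: adjoint_mat_def matrix_matrix_mult_def vec_eq_iff mult.commute)

lemma adjoint_mat_one [simp]: "adjoint_mat (mat 1) = mat 1"
  by (auto simp: adjoint_mat_def mat_def vec_eq_iff)

lemma vector_matrix_mult_uminus: "(u :: 'a::ring_1^'n::finite) v* (- A) = - (u v* A)"
  by (simp add: vec_eq_iff vector_matrix_mult_def sum_negf)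

lemma matrix_mult_minus_left: "(- A) ** B = - (A ** (B :: 'a::ring_1^'n::finite^'m::finite))"
  by (simp add: vec_eq_iff matrix_matrix_mult_def sum_negf)
lemma matrix_mult_minus_right: "A ** (- B) = - (A ** (B :: 'a::ring_1^'n::finite^'m::finite))"
  by (simp add: vec_eq_iff matrix_matrix_mult_def sum_negf)

lemma matrix_add_rdistrib: "(A + B) ** C = A ** C + B ** (C :: 'a::semiring_1^'n::finite^'m::finite)"
  by (simp add: vec_eq_iff matrix_matrix_mult_def sum.distrib ring_distribs)
lemma matrix_sub_ldistrib: "A ** (B - C) = A ** B - A ** (C :: 'a::ring_1^'n::finite^'m::finite)"
  by (simp add: vec_eq_iff matrix_matrix_mult_def sum_subtractf ring_distribs)
lemma matrix_sub_rdistrib: "(A - B) ** C = A ** C - B ** (C :: 'a::ring_1^'n::finite^'m::finite)"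
  by (simp add: vec_eq_iff matrix_matrix_mult_def sum_subtractf ring_distribs)

lemma matrix_mult_zero:
  "A ** 0 = (0 :: 'a::semiring_1^'n::finite^'m::finite)" "0 ** B = (0 :: 'a^'n^'m)"
  by (simp_all add: vec_eq_iff matrix_matrix_mult_def)

lemma vector_matrix_mult_sum_left: "(\<Sum>i\<in>I. p i) v* A = (\<Sum>i\<in>I. (p i :: complex^'n::finite) v* A)"
  by (induction I rule: infinite_finite_induct) (auto simp: vector_matrix_left_distrib)

lemma dotc_hermitian_real:
  assumes "adjoint_mat K = K" shows "dotc (u v* K) u \<in> \<real>"
  unfolding Reals_cnj_iff cnj_dotc dotc_adjoint assms ..

lemma adjoint_inverse_hermitian:
  fixes K T :: "complex^'n::finite^'n"
  assumes T: "adjoint_mat T = T" and KT: "K ** T = mat 1"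
  shows "adjoint_mat K = K"
proof -
  have "T ** adjoint_mat K = mat 1"
    using arg_cong[OF KT, of adjoint_mat] by (simp add: adjoint_mat_mult T)
  then have "K ** T ** adjoint_mat K = K" by (metis matrix_mul_assoc matrix_mul_rid)
  with KT show ?thesis by simp
qed

definition wirtinger_vec ::
  "complex \<Rightarrow> 'd::finite \<Rightarrow> (complex^'d \<Rightarrow> complex^'n::finite) \<Rightarrow> complex^'d \<Rightarrow> complex^'n" where
  "wirtinger_vec \<kappa> a V x = (\<chi> i. wirtinger \<kappa> a (\<lambda>y. V y $ i) x)"

definition wirtinger_mat ::
  "complex \<Rightarrow> 'd::finite \<Rightarrow> (complex^'d \<Rightarrow> complex^'n::finite^'m::finite) \<Rightarrow> complex^'d \<Rightarrow> complex^'n^'m" where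
  "wirtinger_mat \<kappa> a M x = (\<chi> i j. wirtinger \<kappa> a (\<lambda>y. M y $ i $ j) x)"

abbreviation diff_vec :: "(complex^'d::finite \<Rightarrow> complex^'n::finite) \<Rightarrow> complex^'d \<Rightarrow> bool" where
  "diff_vec V x \<equiv> \<forall>i. (\<lambda>y. V y $ i) differentiable at x"

abbreviation diff_mat :: "(complex^'d::finite \<Rightarrow> complex^'n::finite^'m::finite) \<Rightarrow> complex^'d \<Rightarrow> bool" where
  "diff_mat M x \<equiv> \<forall>i j. (\<lambda>y. M y $ i $ j) differentiable at x"

lemma diff_mat_mult: "diff_mat A x \<Longrightarrow> diff_mat B x \<Longrightarrow> diff_mat (\<lambda>y. A y ** B y) x"
  by (auto simp: matrix_matrix_mult_def intro!: differentiable_sum differentiable_mult)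

lemma diff_vec_mult: "diff_vec V x \<Longrightarrow> diff_mat A x \<Longrightarrow> diff_vec (\<lambda>y. V y v* A y) x"
  by (auto simp: vector_matrix_mult_def intro!: differentiable_sum differentiable_mult)

lemma diff_dotc: "diff_vec V x \<Longrightarrow> diff_vec W x \<Longrightarrow> (\<lambda>y. dotc (V y) (W y)) differentiable at x"
  by (auto simp: dotc_def intro!: differentiable_sum differentiable_mult differentiable_cnj)

lemma wirtinger_mat_mult:
  assumes "diff_mat A x" "diff_mat B x"
  shows "wirtinger_mat \<kappa> a (\<lambda>y. A y ** B y) x
       = wirtinger_mat \<kappa> a A x ** B x + A x ** wirtinger_mat \<kappa> a B x"
  using assms
  by (simp add: wirtinger_mat_def matrix_matrix_mult_def vec_eq_iff wirtinger_sum wirtinger_mult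
      differentiable_mult sum.distrib)

lemma wirtinger_vec_mult:
  assumes "diff_vec V x" "diff_mat A x"
  shows "wirtinger_vec \<kappa> a (\<lambda>y. V y v* A y) x
       = wirtinger_vec \<kappa> a V x v* A x + V x v* wirtinger_mat \<kappa> a A x"
  using assms
  by (simp add: wirtinger_mat_def wirtinger_vec_def vector_matrix_mult_def vec_eq_iff wirtinger_sum
      wirtinger_mult differentiable_mult sum.distrib)

lemma wirtinger_dotc:
  assumes "diff_vec V x" "diff_vec W x"
  shows "wirtinger \<kappa> a (\<lambda>y. dotc (V y) (W y)) x
       = dotc (wirtinger_vec \<kappa> a V x) (W x) + dotc (V x) (wirtinger_vec (cnj \<kappa>) a W x)"
  using assms
  by (simp add: wirtinger_vec_def dotc_def wirtinger_sum wirtinger_mult differentiable_mult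
      differentiable_cnj cnj_wirtinger sum.distrib)

lemma wirtinger_mat_cong:
  assumes "\<forall>\<^sub>F y in nhds x. A y = B y"
  shows "wirtinger_mat \<kappa> a A x = wirtinger_mat \<kappa> a B x"
  unfolding wirtinger_mat_def using assms
  by (auto simp: vec_eq_iff intro!: wirtinger_cong elim: eventually_mono)

text \<open>Differentiate \<open>K T = 1\<close> and multiply by \<open>K = T\<^sup>-\<^sup>1\<close> on the right.\<close>

lemma wirtinger_mat_inverse:
  fixes K T :: "complex^'d::finite \<Rightarrow> complex^'n::finite^'n"
  assumes KT: "\<forall>\<^sub>F y in nhds x. K y ** T y = mat 1" and K: "diff_mat K x" and T: "diff_mat T x"
  shows "wirtinger_mat \<kappa> a K x = - (K x ** wirtinger_mat \<kappa> a T x ** K x)"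
proof -
  have KT0: "K x ** T x = mat 1" using KT by (rule eventually_nhds_x_imp_x)
  then have TK0: "T x ** K x = mat 1" by (simp add: matrix_left_right_inverse)
  have "wirtinger_mat \<kappa> a (\<lambda>y. K y ** T y) x = wirtinger_mat \<kappa> a (\<lambda>y. mat 1) x"
    using KT by (rule wirtinger_mat_cong)
  also have "\<dots> = 0" by (simp add: wirtinger_mat_def vec_eq_iff)
  finally have "wirtinger_mat \<kappa> a K x ** T x + K x ** wirtinger_mat \<kappa> a T x = 0"
    by (simp add: wirtinger_mat_mult K T)
  then have "wirtinger_mat \<kappa> a K x ** T x = - (K x ** wirtinger_mat \<kappa> a T x)"
    by (simp add: eq_neg_iff_add_eq_0)
  then have "wirtinger_mat \<kappa> a K x ** T x ** K x = - (K x ** wirtinger_mat \<kappa> a T x) ** K x" by simp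
  then show ?thesis by (simp add: TK0 matrix_mult_minus_left flip: matrix_mul_assoc)
qed

lemma wirtinger_mat_adjoint:
  assumes "\<forall>\<^sub>F y in nhds x. adjoint_mat (T y) = T y" and "diff_mat T x"
  shows "adjoint_mat (wirtinger_mat \<kappa> a T x) = wirtinger_mat (cnj \<kappa>) a T x"
proof -
  have "wirtinger (cnj \<kappa>) a (\<lambda>y. cnj (T y $ j $ i)) x = wirtinger (cnj \<kappa>) a (\<lambda>y. T y $ i $ j) x" for i j
    using assms(1) by (intro wirtinger_cong) (auto simp: adjoint_mat_def vec_eq_iff elim: eventually_mono)
  with assms(2) show ?thesis
    by (simp add: adjoint_mat_def wirtinger_mat_def vec_eq_iff cnj_wirtinger)
qed

lemma matrix_inv_mult:
  fixes A :: "complex^'n::finite^'n"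
  assumes "invertible A"
  shows "A ** matrix_inv A = mat 1" "matrix_inv A ** A = mat 1"
  using someI_ex[OF assms[unfolded invertible_def]] unfolding matrix_inv_def by auto

text \<open>Cramer's rule presents the entries of the inverse as quotients of polynomials in the entries of the
matrix, which is how differentiability is transferred to the inverse.\<close>

lemma matrix_inv_entry_cramer:
  fixes A :: "complex^'n::finite^'n"
  assumes "invertible A"
  shows "matrix_inv A $ k $ l = det (\<chi> i j. if j = k then axis l 1 $ i else A $ i $ j) / det A"
proof -
  have "A *v (\<chi> k. matrix_inv A $ k $ l) = axis l 1"
    using matrix_inv_mult(1)[OF assms]
    by (simp add: vec_eq_iff matrix_matrix_mult_def matrix_vector_mult_def mat_def axis_def)
  then show ?thesis
    using cramer[of A "\<chi> k. matrix_inv A $ k $ l" "axis l 1"] assms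
    by (simp add: invertible_det_nz vec_eq_iff)
qed

lemma twice_diff_det:
  assumes "\<And>i j. twice_diff (\<lambda>y. M y $ i $ j) x"
  shows "twice_diff (\<lambda>y. det (M y :: complex^'n::finite^'n)) x"
  unfolding det_def by (intro twice_diff_sum twice_diff_mult twice_diff_prod assms twice_diff_const)

lemma twice_diff_matrix_inv:
  fixes A :: "'v::euclidean_space \<Rightarrow> complex^'n::finite^'n"
  assumes A: "\<And>i j. twice_diff (\<lambda>y. A y $ i $ j) x" and inv: "\<forall>\<^sub>F y in nhds x. invertible (A y)"
  shows "twice_diff (\<lambda>y. matrix_inv (A y) $ k $ l) x"
proof -
  have B: "twice_diff (\<lambda>y. (\<chi> i j. if j = k then axis l 1 $ i else A y $ i $ j) $ i' $ j') x" for i' j'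
    using A by (cases "j' = k") auto
  have "det (A x) \<noteq> 0" using eventually_nhds_x_imp_x[OF inv] by (simp add: invertible_det_nz)
  then have "twice_diff (\<lambda>y. det (\<chi> i j. if j = k then axis l 1 $ i else A y $ i $ j) * inverse (det (A y))) x"
    by (intro twice_diff_mult twice_diff_inverse twice_diff_det A B)
  then show ?thesis
    by (rule twice_diff_cong)
       (use inv in \<open>auto simp: matrix_inv_entry_cramer divide_inverse elim: eventually_mono\<close>)
qed

text \<open>Transposing exchanges the roles of \<open>u\<close> and its conjugate, so the form of the transposed metric at
\<open>u\<close> is the form of the metric at the conjugate of \<open>u\<close>.\<close>

lemma dotc_transpose_metric:
  "dotc (u v* transpose H) u = (\<Sum>\<alpha>\<in>UNIV. \<Sum>\<beta>\<in>UNIV. H $ \<alpha> $ \<beta> * cnj (u $ \<alpha>) * cnj (cnj (u $ \<beta>)))"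
  unfolding dotc_matrix by (subst sum.swap) (simp add: transpose_def mult_ac)

text \<open>Positivity of the inverse is inherited through \<open>u H\<^sup>-\<^sup>1 u\<^sup>* = w H w\<^sup>*\<close> with \<open>w = u H\<^sup>-\<^sup>1\<close>, where
\<open>H\<close> stands for the transposed metric.\<close>

lemma
  assumes "hermitian_pos_def H"
  shows adjoint_transpose_metric: "adjoint_mat (transpose H) = transpose H"
    and invertible_transpose_metric: "invertible (transpose H)"
    and inv_metric_mult: "inv_metric H ** transpose H = mat 1"
    and adjoint_inv_metric: "adjoint_mat (inv_metric H) = inv_metric H"
    and inv_metric_pos: "u \<noteq> 0 \<Longrightarrow> 0 < Re (dotc (u v* inv_metric H) u)"
proof -
  have herm: "H $ \<alpha> $ \<beta> = cnj (H $ \<beta> $ \<alpha>)" for \<alpha> \<beta>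
    using assms unfolding hermitian_pos_def_def by blast
  show adjT: "adjoint_mat (transpose H) = transpose H"
  proof -
    have "adjoint_mat (transpose H) $ i $ j = transpose H $ i $ j" for i j
      using herm[of j i] by (simp add: adjoint_mat_def transpose_def)
    then show ?thesis by (simp add: vec_eq_iff)
  qed
  have pos: "0 < Re (dotc (u v* transpose H) u)" if "u \<noteq> 0" for u
  proof -
    define v where "v = (\<chi> i. cnj (u $ i))"
    have "v \<noteq> 0" using that by (simp add: v_def vec_eq_iff)
    then have "0 < Re (\<Sum>\<alpha>\<in>UNIV. \<Sum>\<beta>\<in>UNIV. H $ \<alpha> $ \<beta> * v $ \<alpha> * cnj (v $ \<beta>))"
      using assms unfolding hermitian_pos_def_def by blast
    then show ?thesis unfolding dotc_transpose_metric v_def by simp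
  qed
  have "w = 0" if "H *v w = 0" for w
    using pos[of w] that by (auto simp: vector_transpose_matrix)
  then have "invertible H"
    using matrix_left_invertible_ker invertible_left_inverse by blast
  then show inv: "invertible (transpose H)" by (simp add: invertible_det_nz)
  show KT: "inv_metric H ** transpose H = mat 1"
    unfolding inv_metric_def by (rule matrix_inv_mult(2)[OF inv])
  show adjK: "adjoint_mat (inv_metric H) = inv_metric H"
    by (rule adjoint_inverse_hermitian[OF adjT KT])
  assume u: "u \<noteq> 0"
  define w where "w = u v* inv_metric H"
  have wu: "w v* transpose H = u"
    unfolding w_def vector_matrix_mul_assoc KT by simp
  have "dotc (u v* inv_metric H) u = dotc w (w v* transpose H)" by (simp only: wu flip: w_def)
  also have "\<dots> = dotc (w v* transpose H) w" unfolding dotc_adjoint adjT ..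
  finally show "0 < Re (dotc (u v* inv_metric H) u)"
    using pos[of w] u wu by (metis vector_matrix_mult_0)
qed

section \<open>Completing the square\<close>

text \<open>The purely algebraic content of the main computation. Here \<open>A\<close> and \<open>B\<close> stand for \<open>T\<^sub>a\<close> and
\<open>T\<^sub>b\<^sub>-\<close>, \<open>A'\<close> for \<open>T\<^sub>b\<close>, \<open>C\<close> for \<open>T\<^sub>a\<^sub>b\<^sub>-\<close>, \<open>W\<close> and \<open>W'\<close> for \<open>\<partial>\<^sub>aV\<close> and \<open>\<partial>\<^sub>bV\<close>, and \<open>p\<close>,
\<open>q\<close> for the logarithmic derivatives of \<open>G\<close> with respect to \<open>z\<^sup>a\<close> and the conjugate of \<open>z\<^sup>b\<close>. The four
groups on the left are \<open>\<Phi>\<^sub>a\<^sub>b\<^sub>-\<close>, \<open>\<Phi>\<^sub>a q\<close>, \<open>\<Phi>\<^sub>b\<^sub>- p\<close> and \<open>\<Phi> p q\<close>, followed by the curvature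
term. Of the two terms in which both first derivatives of \<open>T\<close> occur in \<open>\<partial>\<^sub>a\<partial>\<^sub>b\<^sub>-K\<close>, the curvature
absorbs \<open>K B K A K\<close>, and \<open>K A K B K\<close> comes from the product of the corrections \<open>V K A\<close> and
\<open>V K A'\<close>.\<close>

lemma dotc_square_completion:
  fixes K A A' B C :: "complex^'n::finite^'n" and V W W' :: "complex^'n"
  assumes K: "adjoint_mat K = K" and B: "adjoint_mat A' = B"
  defines "DK \<equiv> - (K ** A ** K)"
  shows
    "- (dotc (W v* (K ** B ** K)) V
        + dotc (V v* ((DK ** B + K ** C) ** K + K ** B ** DK)) V)
     + dotc (W v* K + V v* DK) W'
     - (dotc (W v* K + V v* DK) V) * q
     - (dotc (V v* K) W' - dotc (V v* (K ** B ** K)) V) * p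
     + dotc (V v* K) V * p * q
     - dotc (V v* (K ** (B ** K ** A - C) ** K)) V
   = dotc ((W - V v* (K ** A) - p *s V) v* K) (W' - V v* (K ** A') - cnj q *s V)"
  unfolding DK_def
  by (simp add: dotc_add_left dotc_add_right dotc_diff_left dotc_diff_right dotc_minus_left
      dotc_smult_left dotc_smult_right dotc_adjoint adjoint_mat_mult K B
      vector_matrix_left_distrib vector_matrix_mult_diff_distrib vector_matrix_mult_add_rdistrib
      vector_matrix_mult_diff_rdistrib vector_matrix_mult_uminus vector_matrix_mul_assoc
      scalar_vector_matrix_assoc matrix_add_ldistrib matrix_add_rdistrib matrix_sub_ldistrib matrix_sub_rdistrib
      matrix_mult_minus_left matrix_mult_minus_right matrix_mul_assoc ring_distribs)

text \<open>The terms with a second derivative of \<open>G\<close> cancel: \<open>F/G\<close> contributes \<open>-F G\<^sub>a\<^sub>b/G\<^sup>2\<close> and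
\<open>log G\<^sup>-\<^sup>1\<close> contributes \<open>-G\<^sub>a\<^sub>b/G\<close>, multiplied by \<open>F/G\<close>.\<close>

lemma wirtinger_quotient:
  fixes a b :: "'d::finite" and \<kappa> \<mu> :: complex and F G :: "complex^'d \<Rightarrow> complex"
  assumes F: "twice_diff F x" and G: "twice_diff G x"
    and pos: "\<forall>\<^sub>F y in nhds x. G y \<in> \<real> \<and> 0 < Re (G y)"
  defines "p \<equiv> wirtinger \<kappa> a G x / G x" and "q \<equiv> wirtinger \<mu> b G x / G x"
  shows "wirtinger \<kappa> a (wirtinger \<mu> b (\<lambda>y. F y * inverse (G y))) x
       - wirtinger \<kappa> a (wirtinger \<mu> b (\<lambda>y. ln (inverse (G y)))) x * (F x * inverse (G x))
     = (wirtinger \<kappa> a (wirtinger \<mu> b F) x - wirtinger \<kappa> a F x * q - wirtinger \<mu> b F x * p + F x * p * q) / G x"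
proof -
  have G0: "G x \<noteq> 0" using eventually_nhds_x_imp_x[OF pos] by auto
  have dF: "\<forall>\<^sub>F y in nhds x. F differentiable at y" and dG: "\<forall>\<^sub>F y in nhds x. G differentiable at y"
    by (rule twice_diff_eventually_differentiable, fact)+
  have dFx: "F differentiable at x" and dGx: "G differentiable at x"
    by (rule twice_diff_imp_differentiable, fact)+
  note d2F = twice_diff_wirtinger_differentiable[OF F, of \<mu> b]
  note d2G = twice_diff_wirtinger_differentiable[OF G, of \<mu> b]
  have dI: "(\<lambda>y. inverse (G y)) differentiable at x"
    by (rule differentiable_inverse[OF dGx G0])
  have 1: "\<forall>\<^sub>F y in nhds x. wirtinger \<mu> b (\<lambda>y. F y * inverse (G y)) y =
     wirtinger \<mu> b F y * inverse (G y) - F y * (wirtinger \<mu> b G y * (inverse (G y) * inverse (G y)))"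
    using dF dG pos
  proof eventually_elim
    case (elim y)
    then have "G y \<noteq> 0" by auto
    with elim show ?case
      by (simp add: wirtinger_mult differentiable_inverse wirtinger_inverse power2_eq_square divide_inverse)
  qed
  have 2: "\<forall>\<^sub>F y in nhds x. wirtinger \<mu> b (\<lambda>y. ln (inverse (G y))) y =
     - (wirtinger \<mu> b G y * inverse (G y))"
    using dG pos by eventually_elim (simp add: wirtinger_ln_inverse divide_inverse)
  note d = differentiable_mult differentiable_diff differentiable_minus dFx dGx d2F d2G dI
  show ?thesis
    unfolding wirtinger_cong[OF 1] wirtinger_cong[OF 2] p_def q_def
    using G0
    by (simp del: inverse_mult_distrib add: wirtinger_diff wirtinger_minus wirtinger_mult wirtinger_inverse d)
       (simp add: field_simps power2_eq_square)
qed

text \<open>Since \<open>V\<close> is holomorphic, its conjugate derivatives drop out of the first and second derivatives of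
\<open>V K V\<^sup>*\<close>, and what is left is the algebraic identity \<open>dotc_square_completion\<close>.\<close>

lemma wirtinger_square_formula:
  fixes K T :: "complex^'d::finite \<Rightarrow> complex^'n::finite^'n" and V :: "complex^'d \<Rightarrow> complex^'n"
  assumes KT: "\<forall>\<^sub>F y in nhds x. K y ** T y = mat 1"
    and T_adj: "\<forall>\<^sub>F y in nhds x. adjoint_mat (T y) = T y"
    and T: "\<And>i j. twice_diff (\<lambda>y. T y $ i $ j) x"
    and K: "\<And>i j. twice_diff (\<lambda>y. K y $ i $ j) x"
    and V: "\<And>i. twice_diff (\<lambda>y. V y $ i) x"
    and V_hol: "\<And>i b. \<forall>\<^sub>F y in nhds x. wirtinger \<i> b (\<lambda>y. V y $ i) y = 0"
    and G: "twice_diff G x"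
    and pos: "\<forall>\<^sub>F y in nhds x. G y \<in> \<real> \<and> 0 < Re (G y)"
  defines "Y \<equiv> \<lambda>y. dotc (V y v* K y) (V y) * inverse (G y)"
    and "S \<equiv> \<lambda>a. wirtinger_vec (-\<i>) a V x - V x v* (K x ** wirtinger_mat (-\<i>) a T x)
                - (wirtinger (-\<i>) a G x / G x) *s V x"
    and "C \<equiv> \<lambda>a b. K x ** (wirtinger_mat \<i> b T x ** K x ** wirtinger_mat (-\<i>) a T x
                - wirtinger_mat (-\<i>) a (wirtinger_mat \<i> b T) x) ** K x"
  shows "wirtinger (-\<i>) a (wirtinger \<i> b Y) x
       - wirtinger (-\<i>) a (wirtinger \<i> b (\<lambda>y. ln (inverse (G y)))) x * Y x
       - dotc (V x v* C a b) (V x) / G x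
     = dotc (S a v* K x) (S b) / G x"
proof -
  have dK: "\<forall>\<^sub>F y in nhds x. diff_mat K y" and dT: "\<forall>\<^sub>F y in nhds x. diff_mat T y"
    and dV: "\<forall>\<^sub>F y in nhds x. diff_vec V y"
    using K T V by (auto simp: eventually_all_finite twice_diff_eventually_differentiable)
  have KT': "\<forall>\<^sub>F y in nhds x. \<forall>\<^sub>F z in nhds y. K z ** T z = mat 1"
    using KT by (simp add: eventually_eventually)
  have V_hol': "\<forall>\<^sub>F y in nhds x. wirtinger_vec \<i> c V y = 0" for c
    using V_hol[of c] eventually_all_finite[of "\<lambda>y i. wirtinger \<i> c (\<lambda>y. V y $ i) y = 0"]
    by (auto simp: wirtinger_vec_def vec_eq_iff)
  define F where "F y = dotc (V y v* K y) (V y)" for y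
  define B where "B = wirtinger_mat \<i> b T"
  define W where "W = wirtinger_vec (-\<i>) b V"
  note at_x = eventually_nhds_x_imp_x
  have dB: "diff_mat B x" and dW: "diff_vec W x"
    unfolding B_def W_def wirtinger_mat_def wirtinger_vec_def
    using twice_diff_wirtinger_differentiable[OF T] twice_diff_wirtinger_differentiable[OF V] by auto
  note dKx = at_x[OF dK] and dTx = at_x[OF dT] and dVx = at_x[OF dV]
  have F: "twice_diff F x"
    unfolding F_def dotc_def vector_matrix_mult_def
    by (simp, intro twice_diff_sum twice_diff_mult twice_diff_cnj K V)
  have Fb: "\<forall>\<^sub>F y in nhds x. wirtinger \<i> b F y =
       dotc (V y v* K y) (W y) - dotc (V y v* (K y ** B y ** K y)) (V y)"
    using dK dT dV KT' V_hol'[of b]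
  proof eventually_elim
    case (elim y)
    then show ?case
      unfolding F_def B_def W_def
      by (simp add: wirtinger_dotc wirtinger_vec_mult diff_vec_mult wirtinger_mat_inverse
          vector_matrix_mult_uminus dotc_minus_left)
  qed
  have DK: "wirtinger_mat (-\<i>) a K x = - (K x ** wirtinger_mat (-\<i>) a T x ** K x)"
    by (rule wirtinger_mat_inverse[OF KT dKx dTx])
  have Vb: "wirtinger_vec \<i> c V x = 0" for c by (rule at_x[OF V_hol'])
  \<comment> \<open>The conjugate derivatives of the holomorphic \<open>V\<close> vanish near \<open>x\<close>, and \<open>\<partial>\<^sub>b\<close> commutes with them.\<close>
  have Wb: "wirtinger_vec \<i> a W x = 0"
  proof -
    have "wirtinger \<i> a (wirtinger (-\<i>) b (\<lambda>y. V y $ i)) x = 0" for i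
      using wirtinger_commute[OF V, of \<i> a "-\<i>" b i] wirtinger_cong[OF V_hol[of a i]]
      by simp
    then show ?thesis by (simp add: W_def wirtinger_vec_def vec_eq_iff)
  qed
  have Fa: "wirtinger (-\<i>) a F x
      = dotc (wirtinger_vec (-\<i>) a V x v* K x + V x v* wirtinger_mat (-\<i>) a K x) (V x)"
    unfolding F_def
    by (simp add: wirtinger_dotc wirtinger_vec_mult diff_vec_mult dKx dVx Vb)
  have Fab: "wirtinger (-\<i>) a (wirtinger \<i> b F) x
      = - (dotc (wirtinger_vec (-\<i>) a V x v* (K x ** B x ** K x)) (V x)
        + dotc (V x v* ((wirtinger_mat (-\<i>) a K x ** B x + K x ** wirtinger_mat (-\<i>) a B x) ** K x
              + K x ** B x ** wirtinger_mat (-\<i>) a K x)) (V x))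
        + dotc (wirtinger_vec (-\<i>) a V x v* K x + V x v* wirtinger_mat (-\<i>) a K x) (W x)"
    unfolding wirtinger_cong[OF Fb]
    by (simp add: wirtinger_diff diff_dotc
        wirtinger_dotc wirtinger_vec_mult diff_vec_mult diff_mat_mult wirtinger_mat_mult
        dKx dVx dB dW Vb Wb dotc_add_left)
  have T_adj_x: "adjoint_mat (T x) = T x" by (rule at_x[OF T_adj])
  have adjK: "adjoint_mat (K x) = K x"
    by (rule adjoint_inverse_hermitian[OF T_adj_x at_x[OF KT]])
  have adjT: "adjoint_mat (wirtinger_mat (-\<i>) b T x) = B x"
    unfolding B_def using wirtinger_mat_adjoint[OF T_adj dTx, of "-\<i>" b] by simp
  have Gcnj: "cnj (wirtinger \<i> b G x / G x) = wirtinger (-\<i>) b G x / G x"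
  proof -
    have "wirtinger (-\<i>) b (\<lambda>y. cnj (G y)) x = wirtinger (-\<i>) b G x"
      using pos by (intro wirtinger_cong) (auto simp: Reals_cnj_iff elim: eventually_mono)
    moreover have "cnj (G x) = G x" using at_x[OF pos] by (simp add: Reals_cnj_iff)
    ultimately show ?thesis
      using cnj_wirtinger[OF twice_diff_imp_differentiable[OF G], of \<i> b] by simp
  qed
  have "wirtinger (-\<i>) a (wirtinger \<i> b Y) x
       - wirtinger (-\<i>) a (wirtinger \<i> b (\<lambda>y. ln (inverse (G y)))) x * Y x
       - dotc (V x v* C a b) (V x) / G x =
     (wirtinger (-\<i>) a (wirtinger \<i> b F) x - wirtinger (-\<i>) a F x * (wirtinger \<i> b G x / G x)
       - wirtinger \<i> b F x * (wirtinger (-\<i>) a G x / G x)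
       + F x * (wirtinger (-\<i>) a G x / G x) * (wirtinger \<i> b G x / G x)
       - dotc (V x v* C a b) (V x)) / G x"
    using wirtinger_quotient[OF F G pos, of "-\<i>" a \<i> b]
    unfolding Y_def F_def[symmetric] diff_divide_distrib[of _ "dotc (V x v* C a b) (V x)"] by simp
  also have "\<dots> = dotc (S a v* K x) (S b) / G x"
    unfolding Fab Fa at_x[OF Fb] DK F_def C_def S_def Gcnj[symmetric]
    unfolding B_def[symmetric] W_def[symmetric]
    by (subst dotc_square_completion[OF adjK adjT, symmetric]) (rule refl)
  finally show ?thesis .
qed

text \<open>The Gram matrix \<open>S\<^sub>a K S\<^sub>b\<^sup>*\<close> is positive semidefinite and Hermitian. The form \<open>P\<close> is real because it
consists of mixed second derivatives of a real function; \<open>Q\<close> is real as the difference of the two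
real forms \<open>P\<close> and \<open>P - Q\<close>.\<close>

lemma form_ge_of_square:
  fixes K T :: "complex^'d::finite \<Rightarrow> complex^'n::finite^'n" and V :: "complex^'d \<Rightarrow> complex^'n"
  assumes KT: "\<forall>\<^sub>F y in nhds x. K y ** T y = mat 1"
    and T_adj: "\<forall>\<^sub>F y in nhds x. adjoint_mat (T y) = T y"
    and T: "\<And>i j. twice_diff (\<lambda>y. T y $ i $ j) x"
    and K: "\<And>i j. twice_diff (\<lambda>y. K y $ i $ j) x"
    and V: "\<And>i. twice_diff (\<lambda>y. V y $ i) x"
    and V_hol: "\<And>i b. \<forall>\<^sub>F y in nhds x. wirtinger \<i> b (\<lambda>y. V y $ i) y = 0"
    and G: "twice_diff G x"
    and pos: "\<forall>\<^sub>F y in nhds x. G y \<in> \<real> \<and> 0 < Re (G y)"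
    and K_pos: "\<And>u. 0 \<le> Re (dotc (u v* K x) u)"
  defines "Y \<equiv> \<lambda>y. dotc (V y v* K y) (V y) * inverse (G y)"
    and "C \<equiv> \<lambda>a b. K x ** (wirtinger_mat \<i> b T x ** K x ** wirtinger_mat (-\<i>) a T x
                - wirtinger_mat (-\<i>) a (wirtinger_mat \<i> b T) x) ** K x"
  assumes P: "\<And>a b. P $ a $ b = wirt a (wirt_bar b Y) x"
    and Q: "\<And>a b. Q $ a $ b = wirt a (wirt_bar b (\<lambda>y. ln (inverse (G y)))) x * Y x
                     + dotc (V x v* C a b) (V x) / G x"
  shows "form_ge I P Q"
proof -
  define S where "S a = wirtinger_vec (-\<i>) a V x - V x v* (K x ** wirtinger_mat (-\<i>) a T x)
                - (wirtinger (-\<i>) a G x / G x) *s V x" for a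
  have PQ: "P $ a $ b - Q $ a $ b = dotc (S a v* K x) (S b) / G x" for a b
    unfolding P Q S_def Y_def C_def
    using wirtinger_square_formula[OF KT T_adj T K V V_hol G pos, of a b]
    by (simp add: wirt_eq_wirtinger wirt_bar_eq_wirtinger diff_diff_eq)
  have adjK: "\<forall>\<^sub>F y in nhds x. adjoint_mat (K y) = K y"
    using KT T_adj by eventually_elim (rule adjoint_inverse_hermitian)
  have adjKx: "adjoint_mat (K x) = K x" by (rule eventually_nhds_x_imp_x[OF adjK])
  obtain r where r: "G x = of_real r" "r > 0"
    using eventually_nhds_x_imp_x[OF pos] by (auto elim!: Reals_cases)
  have "twice_diff Y x"
    unfolding Y_def dotc_def vector_matrix_mult_def using r
    by (simp, intro twice_diff_sum twice_diff_mult twice_diff_cnj twice_diff_inverse K V G) auto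
  moreover have "\<forall>\<^sub>F y in nhds x. Y y \<in> \<real>"
    using adjK pos unfolding Y_def by eventually_elim (auto intro!: Reals_mult Reals_inverse dotc_hermitian_real)
  ultimately have P_real: "real_form I P"
    unfolding real_form_def P using hermitian_second_derivatives by blast
  have S_herm: "cnj (dotc (S b v* K x) (S a)) = dotc (S a v* K x) (S b)" for a b
    by (simp add: cnj_dotc dotc_adjoint adjKx)
  have "(P - Q) $ a $ b = cnj ((P - Q) $ b $ a)" for a b
    by (simp only: vector_minus_component PQ r(1) complex_cnj_divide S_herm complex_cnj_complex_of_real)
  then have PQ_real: "real_form I (P - Q)" unfolding real_form_def by blast
  have Q_real: "real_form I Q"
    unfolding real_form_def
  proof (intro ballI)
    fix a b assume "a \<in> I" "b \<in> I"
    then have *: "P $ a $ b = cnj (P $ b $ a)" "(P - Q) $ a $ b = cnj ((P - Q) $ b $ a)"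
      using P_real PQ_real unfolding real_form_def by blast+
    have "Q $ a $ b = P $ a $ b - (P - Q) $ a $ b" by simp
    also have "\<dots> = cnj (P $ b $ a - (P - Q) $ b $ a)"
      by (simp only: complex_cnj_diff flip: *)
    finally show "Q $ a $ b = cnj (Q $ b $ a)" by simp
  qed
  have "0 \<le> Re (\<Sum>a\<in>I. \<Sum>b\<in>I. (P - Q) $ a $ b * v $ a * cnj (v $ b))" for v
  proof -
    define Z where "Z = (\<Sum>a\<in>I. v $ a *s S a)"
    have "(\<Sum>a\<in>I. \<Sum>b\<in>I. (P - Q) $ a $ b * v $ a * cnj (v $ b)) = dotc (Z v* K x) Z / G x"
      unfolding Z_def
      by (subst sum.swap)
         (simp add: PQ vector_matrix_mult_sum_left dotc_sum_left dotc_sum_right dotc_smult_left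
          dotc_smult_right scalar_vector_matrix_assoc sum_divide_distrib sum_distrib_left mult_ac)
    then show ?thesis using K_pos[of Z] r by simp
  qed
  with PQ_real have "semipositive_form I (P - Q)" unfolding semipositive_form_def by blast
  with P_real Q_real show ?thesis unfolding form_ge_def by blast
qed

section \<open>Charts of the projectivized bundle\<close>

definition base_coords :: "complex^('m::finite + 'n::finite) \<Rightarrow> complex^'m" where
  "base_coords \<zeta> = (\<chi> \<alpha>. \<zeta> $ Inl \<alpha>)"

text \<open>The representative of the line that is normalized by \<open>X\<^sub>j = 1\<close>, read off from a coordinate vector
without using its dummy entry at \<open>Inr j\<close>.\<close>

definition fibre_coords :: "'n \<Rightarrow> complex^('m::finite + 'n::finite) \<Rightarrow> complex^'n" where
  "fibre_coords j \<zeta> = (\<chi> i. if i = j then 1 else \<zeta> $ Inr i)"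

lemma bounded_linear_base_coords: "bounded_linear base_coords"
  unfolding linear_conv_bounded_linear[symmetric]
  by (rule linearI) (simp_all add: base_coords_def vec_eq_iff)

lemma base_coords_smult: "base_coords (c *s v) = c *s base_coords v"
  by (simp add: base_coords_def vec_eq_iff)

lemma base_coords_axis:
  "base_coords (axis (Inl \<alpha>) s) = axis \<alpha> s" "base_coords (axis (Inr i) s) = 0"
  by (auto simp: base_coords_def vec_eq_iff axis_def)

lemma complex_diff_fibre_coords: "complex_diff (\<lambda>\<zeta>. fibre_coords j \<zeta> $ i) x"
  by (cases "i = j")
     (auto simp: fibre_coords_def intro!: complex_diff_const complex_diff_linear bounded_linear_vec_nth)

lemma fibre_coords_nonzero: "fibre_coords j \<zeta> \<noteq> 0"
proof
  assume "fibre_coords j \<zeta> = 0"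
  then have "fibre_coords j \<zeta> $ j = 0" by simp
  then show False by (simp add: fibre_coords_def)
qed

text \<open>Functions pulled back from \<open>M\<close> have derivatives only in the directions \<open>z\<^sup>\<alpha>\<close>.\<close>

lemma wirtinger_base:
  assumes "F differentiable at (base_coords \<zeta>)"
  shows "wirtinger \<kappa> a (\<lambda>\<zeta>. F (base_coords \<zeta>)) \<zeta>
       = (case a of Inl \<alpha> \<Rightarrow> wirtinger \<kappa> \<alpha> F (base_coords \<zeta>) | Inr _ \<Rightarrow> 0)"
  by (cases a)
     (simp_all add: wirtinger_compose_linear[OF assms bounded_linear_base_coords]
        wirtinger_compose_linear_0[OF assms bounded_linear_base_coords] base_coords_axis)

lemma eventually_base_coords:
  assumes "\<forall>\<^sub>F z in nhds (base_coords \<zeta>). P z"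
  shows "\<forall>\<^sub>F \<zeta>' in nhds \<zeta>. P (base_coords \<zeta>')"
  using assms
  by (rule eventually_compose_filterlim)
     (metis bounded_linear_base_coords isCont_def linear_continuous_at tendsto_at_iff_tendsto_nhds)

lemma wirtinger_base_second:
  assumes F: "twice_diff F (base_coords \<zeta>)"
  shows "wirtinger \<kappa> a (wirtinger \<mu> b (\<lambda>\<zeta>. F (base_coords \<zeta>))) \<zeta>
       = (case (a, b) of (Inl \<alpha>, Inl \<beta>) \<Rightarrow> wirtinger \<kappa> \<alpha> (wirtinger \<mu> \<beta> F) (base_coords \<zeta>) | _ \<Rightarrow> 0)"
proof -
  have ev: "\<forall>\<^sub>F \<zeta> in nhds \<zeta>. wirtinger \<mu> b (\<lambda>\<zeta>. F (base_coords \<zeta>)) \<zeta> =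
       (case b of Inl \<beta> \<Rightarrow> wirtinger \<mu> \<beta> F (base_coords \<zeta>) | Inr _ \<Rightarrow> 0)"
    using eventually_base_coords[OF twice_diff_eventually_differentiable[OF F]]
    by (rule eventually_mono) (rule wirtinger_base)
  show ?thesis
  proof (cases b)
    case (Inl \<beta>)
    have ev': "\<forall>\<^sub>F \<zeta> in nhds \<zeta>. wirtinger \<mu> b (\<lambda>\<zeta>. F (base_coords \<zeta>)) \<zeta> =
        wirtinger \<mu> \<beta> F (base_coords \<zeta>)"
      using ev by (simp add: Inl)
    show ?thesis
      unfolding wirtinger_cong[OF ev'] wirtinger_base[OF twice_diff_wirtinger_differentiable[OF F]]
      by (simp add: Inl split: sum.split)
  next
    case (Inr i)
    have ev': "\<forall>\<^sub>F \<zeta> in nhds \<zeta>. wirtinger \<mu> b (\<lambda>\<zeta>. F (base_coords \<zeta>)) \<zeta> = 0"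
      using ev by (simp add: Inr)
    show ?thesis
      unfolding wirtinger_cong[OF ev'] by (simp add: Inr split: sum.split)
  qed
qed

lemma complex_atlasD:
  assumes "complex_atlas A" "c \<in> A"
  shows "open (fst c)" "homeomorphism (fst c) (snd c ` fst c) (snd c) (coord_inv c)"
    and "open (snd c ` fst c)"
    and "p \<in> fst c \<Longrightarrow> coord_inv c (snd c p) = p"
    and "z \<in> snd c ` fst c \<Longrightarrow> snd c (coord_inv c z) = z"
    and "z \<in> snd c ` fst c \<Longrightarrow> coord_inv c z \<in> fst c"
    and "inj_on (snd c) (fst c)"
proof -
  show "open (fst c)" and hom: "homeomorphism (fst c) (snd c ` fst c) (snd c) (coord_inv c)"
    and "open (snd c ` fst c)"
    using assms unfolding complex_atlas_def by auto
  show "p \<in> fst c \<Longrightarrow> coord_inv c (snd c p) = p" for p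
    using hom by (simp add: homeomorphism_def)
  then show "inj_on (snd c) (fst c)" by (metis inj_on_inverseI)
  show "z \<in> snd c ` fst c \<Longrightarrow> snd c (coord_inv c z) = z"
    "z \<in> snd c ` fst c \<Longrightarrow> coord_inv c z \<in> fst c"
    using hom by (auto simp: homeomorphism_def)
qed

lemma open_chart_image:
  assumes A: "complex_atlas A" "c \<in> A" and W: "open W"
  shows "open (snd c ` (fst c \<inter> W))"
proof -
  have "openin (top_of_set (fst c)) (fst c \<inter> W)" using W by (simp add: openin_open_Int)
  then have "openin (top_of_set (snd c ` fst c)) (snd c ` (fst c \<inter> W))"
    using homeomorphism_imp_open_map[OF complex_atlasD(2)[OF A]] by blast
  then show ?thesis using complex_atlasD(3)[OF A] openin_open_eq by blast
qed

lemma complex_diff_component: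
  assumes "holo_on S F" "x \<in> S"
  shows "complex_diff (\<lambda>y. F y $ i) x"
proof -
  obtain J where J: "(F has_derivative (\<lambda>v. J *v v)) (at x)"
    using assms unfolding holo_on_def by blast
  show ?thesis
  proof (rule complex_diffI)
    show "((\<lambda>y. F y $ i) has_derivative (\<lambda>v. (J *v v) $ i)) (at x)"
      by (rule bounded_linear.has_derivative[OF bounded_linear_vec_nth J])
  qed (simp add: vector_scalar_commute)
qed

lemma wirt_component:
  assumes "(F has_derivative (\<lambda>v. J *v v)) (at x)"
  shows "wirt i (\<lambda>y. F y $ k) x = J $ k $ i"
proof -
  have der: "((\<lambda>y. F y $ k) has_derivative (\<lambda>v. (J *v v) $ k)) (at x)"
    by (rule bounded_linear.has_derivative[OF bounded_linear_vec_nth assms])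
  have ax: "(J *v axis i s) $ k = J $ k $ i * s" for s
    by (simp add: matrix_vector_mult_def axis_def if_distrib[of "\<lambda>t. _ * t"] cong: if_cong)
  show ?thesis
    unfolding wirt_eq_wirtinger wirtinger_has_derivative[OF der] ax by (simp add: algebra_simps)
qed

text \<open>The transposed Jacobian matrix of the transition map: with this order of the indices the change of
frame of a covector is the plain product \<open>jac d d' q *v \<xi> d'\<close>.\<close>

definition jac :: "('b, 'n::finite) chart \<Rightarrow> ('b, 'n) chart \<Rightarrow> 'b \<Rightarrow> complex^'n^'n" where
  "jac d d' q = (\<chi> i k. wirt i (\<lambda>\<eta>. transition d d' \<eta> $ k) (snd d q))"

lemma transition_has_derivative:
  assumes B: "complex_atlas B" "d \<in> B" "d' \<in> B" and q: "q \<in> fst d" "q \<in> fst d'"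
  shows "(transition d d' has_derivative (\<lambda>v. transpose (jac d d' q) *v v)) (at (snd d q))"
proof -
  have "holo_on (snd d ` (fst d \<inter> fst d')) (transition d d')"
    using B unfolding complex_atlas_def by blast
  then obtain J where J: "(transition d d' has_derivative (\<lambda>v. J *v v)) (at (snd d q))"
    using q unfolding holo_on_def by blast
  have "transpose (jac d d' q) = J"
    by (simp add: jac_def transpose_def vec_eq_iff wirt_component[OF J])
  with J show ?thesis by simp
qed

text \<open>The cocycle rule is the chain rule for the composition of two transition maps.\<close>

lemma jac_chain:
  assumes B: "complex_atlas B" "d \<in> B" "d' \<in> B" "d'' \<in> B"
    and q: "q \<in> fst d" "q \<in> fst d'" "q \<in> fst d''"
  shows "jac d d'' q = jac d d' q ** jac d' d'' q"
proof -
  define U where "U = snd d ` (fst d \<inter> fst d')"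
  have "open U" unfolding U_def
    using B complex_atlasD(1)[OF B(1,3)] by (intro open_chart_image)
  have qU: "snd d q \<in> U" using q by (simp add: U_def)
  have tq: "transition d d' (snd d q) = snd d' q"
    using complex_atlasD(4)[OF B(1,2) q(1)] by (simp add: transition_def)
  have "(transition d d'' has_derivative
      (\<lambda>v. transpose (jac d' d'' q) *v (transpose (jac d d' q) *v v))) (at (snd d q))"
  proof (rule has_derivative_transform_within_open[OF _ \<open>open U\<close> qU])
    show "((\<lambda>\<eta>. transition d' d'' (transition d d' \<eta>)) has_derivative
      (\<lambda>v. transpose (jac d' d'' q) *v (transpose (jac d d' q) *v v))) (at (snd d q))"
      by (rule has_derivative_compose[OF transition_has_derivative[OF B(1,2,3) q(1,2)]])
         (unfold tq, rule transition_has_derivative[OF B(1,3,4) q(2,3)])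
    fix \<eta> assume "\<eta> \<in> U"
    then show "transition d' d'' (transition d d' \<eta>) = transition d d'' \<eta>"
      unfolding U_def transition_def using complex_atlasD(4)[OF B(1,2)] complex_atlasD(4)[OF B(1,3)] by auto
  qed
  then have der: "(transition d d'' has_derivative
      (\<lambda>v. (transpose (jac d' d'' q) ** transpose (jac d d' q)) *v v)) (at (snd d q))"
    unfolding matrix_vector_mul_assoc .
  have "jac d d'' q $ i $ k = (transpose (jac d' d'' q) ** transpose (jac d d' q)) $ k $ i" for i k
    unfolding jac_def[of d d''] using wirt_component[OF der] by simp
  then show ?thesis
    by (simp add: vec_eq_iff matrix_matrix_mult_def transpose_def mult.commute)
qed

lemma jac_self:
  assumes B: "complex_atlas B" "d \<in> B" and q: "q \<in> fst d"
  shows "jac d d q = mat 1"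
proof -
  have "(transition d d has_derivative (\<lambda>v. mat 1 *v v)) (at (snd d q))"
  proof (rule has_derivative_transform_within_open[OF _ complex_atlasD(3)[OF B]])
    show "((\<lambda>\<eta>. \<eta>) has_derivative (\<lambda>v. mat 1 *v v)) (at (snd d q))" by simp
  qed (use q complex_atlasD(5)[OF B] in \<open>auto simp: transition_def\<close>)
  from wirt_component[OF this] show ?thesis
    by (simp add: jac_def vec_eq_iff mat_def eq_commute)
qed

lemma cotangent_iff:
  "\<xi> \<in> cotangent B q \<longleftrightarrow> (\<forall>d. d \<notin> B \<or> q \<notin> fst d \<longrightarrow> \<xi> d = 0) \<and>
     (\<forall>d\<in>B. \<forall>d'\<in>B. q \<in> fst d \<inter> fst d' \<longrightarrow> \<xi> d = jac d d' q *v \<xi> d')"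
  by (simp add: cotangent_def jac_def matrix_vector_mult_def vec_eq_iff)

text \<open>Components prescribed in one chart are transported to all charts by the Jacobians; the cocycle rule
makes the resulting family consistent.\<close>

lemma cotangent_extend:
  assumes B: "complex_atlas B" "d \<in> B" and q: "q \<in> fst d"
  obtains \<xi> where "\<xi> \<in> cotangent B q" "\<xi> d = X"
proof
  define \<xi> where "\<xi> e = (if e \<in> B \<and> q \<in> fst e then jac e d q *v X else 0)" for e
  show "\<xi> \<in> cotangent B q"
    unfolding cotangent_iff \<xi>_def using B q
    by (auto simp: matrix_vector_mul_assoc jac_chain[symmetric])
  show "\<xi> d = X" using B q by (simp add: \<xi>_def jac_self)
qed

lemma cotangent_eqI:
  assumes \<xi>: "\<xi> \<in> cotangent B q" and \<xi>': "\<xi>' \<in> cotangent B q" and d: "d \<in> B" "q \<in> fst d"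
    and eq: "\<xi> d = s *s \<xi>' d"
  shows "\<xi> e = s *s \<xi>' e"
proof (cases "e \<in> B \<and> q \<in> fst e")
  case True
  then have "\<xi> e = jac e d q *v \<xi> d" "\<xi>' e = jac e d q *v \<xi>' d"
    using \<xi> \<xi>' d unfolding cotangent_iff by blast+
  then show ?thesis by (simp only: eq vector_scalar_commute)
next
  case False
  then have "\<xi> e = 0" "\<xi>' e = 0" using \<xi> \<xi>' unfolding cotangent_iff by blast+
  then show ?thesis by simp
qed

lemma cotangent_chart_nonzero:
  assumes "\<xi> \<in> cotangent B q" "d \<in> B" "q \<in> fst d" "\<xi> \<noteq> (\<lambda>_. 0)"
  shows "\<xi> d \<noteq> 0"
proof
  assume "\<xi> d = 0"
  then have "\<xi> d = 0 *s \<xi> d" by simp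
  then have "\<xi> e = 0 *s \<xi> e" for e by (rule cotangent_eqI[OF assms(1,1,2,3)])
  then show False using assms(4) by (simp add: fun_eq_iff)
qed

lemma homog_line:
  assumes "\<xi> d \<noteq> 0"
  obtains s where "s \<noteq> 0" "homog d (range (\<lambda>t::complex. \<lambda>e. t *s \<xi> e)) = s *s \<xi> d"
proof -
  let ?L = "range (\<lambda>t::complex. \<lambda>e. t *s \<xi> e)"
  have "\<xi> \<in> ?L" by (rule range_eqI[of _ _ 1]) simp
  then have "\<exists>X. X \<noteq> 0 \<and> X \<in> (\<lambda>\<xi>. \<xi> d) ` ?L" using assms by blast
  then have "homog d ?L \<noteq> 0 \<and> homog d ?L \<in> (\<lambda>\<xi>. \<xi> d) ` ?L"
    unfolding homog_def by (rule someI_ex)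
  then obtain s where "homog d ?L = s *s \<xi> d" "homog d ?L \<noteq> 0" by auto
  then show ?thesis using that[of s] by auto
qed

lemma proj_bundle_homog:
  assumes x: "(p, L) \<in> proj_bundle B f" and d: "d \<in> B" "f p \<in> fst d"
  obtains \<xi> s where "\<xi> \<in> cotangent B (f p)" "L = range (\<lambda>t::complex. \<lambda>e. t *s \<xi> e)"
    "\<xi> d \<noteq> 0" "s \<noteq> 0" "homog d L = s *s \<xi> d"
proof -
  obtain \<xi> where \<xi>: "\<xi> \<in> cotangent B (f p)" "\<xi> \<noteq> (\<lambda>_. 0)"
    and L: "L = range (\<lambda>t::complex. \<lambda>e. t *s \<xi> e)"
    using x unfolding proj_bundle_def by blast
  have "\<xi> d \<noteq> 0" by (rule cotangent_chart_nonzero[OF \<xi>(1) d \<xi>(2)])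
  with homog_line[of \<xi> d] \<xi> L that show ?thesis by metis
qed

text \<open>Equal affine coordinates mean that the components of the two lines in the chart \<open>d\<close> are
proportional; the transformation rule spreads the proportionality factor to all charts.\<close>

lemma inj_on_bundle_chart:
  assumes A: "complex_atlas A" "c \<in> A" and d: "d \<in> B"
  shows "inj_on (bundle_chart c d j) (bundle_dom B f c d j)"
proof (rule inj_onI)
  fix x y assume x: "x \<in> bundle_dom B f c d j" and y: "y \<in> bundle_dom B f c d j"
    and eq: "bundle_chart c d j x = bundle_chart c d j y"
  obtain p L where xp: "x = (p, L)" by force
  obtain p' L' where yp: "y = (p', L')" by force
  have "snd c p $ \<alpha> = snd c p' $ \<alpha>" for \<alpha>
    using arg_cong[OF eq, of "\<lambda>\<zeta>. \<zeta> $ Inl \<alpha>"] by (simp add: bundle_chart_def xp yp)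
  then have "snd c p = snd c p'" by (simp add: vec_eq_iff)
  then have pp: "p' = p"
    using x y complex_atlasD(7)[OF A] by (auto simp: xp yp bundle_dom_def dest: inj_onD)
  have px: "(p, L) \<in> proj_bundle B f" "f p \<in> fst d" "homog d L $ j \<noteq> 0"
    and py: "(p, L') \<in> proj_bundle B f" "homog d L' $ j \<noteq> 0"
    using x y by (auto simp: xp yp pp bundle_dom_def)
  obtain \<xi> s where \<xi>: "\<xi> \<in> cotangent B (f p)" "L = range (\<lambda>t::complex. \<lambda>e. t *s \<xi> e)"
    "\<xi> d \<noteq> 0" "s \<noteq> 0" "homog d L = s *s \<xi> d"
    using proj_bundle_homog[OF px(1) d px(2)] .
  obtain \<xi>' s' where \<xi>': "\<xi>' \<in> cotangent B (f p)" "L' = range (\<lambda>t::complex. \<lambda>e. t *s \<xi>' e)"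
    "\<xi>' d \<noteq> 0" "s' \<noteq> 0" "homog d L' = s' *s \<xi>' d"
    using proj_bundle_homog[OF py(1) d px(2)] .
  define r where "r = \<xi> d $ j / \<xi>' d $ j"
  have nz: "\<xi> d $ j \<noteq> 0" "\<xi>' d $ j \<noteq> 0" using px(3) py(2) \<xi>(5) \<xi>'(5) by auto
  have "\<xi> d $ i = r * \<xi>' d $ i" for i
  proof -
    have "homog d L $ i / homog d L $ j = homog d L' $ i / homog d L' $ j"
      using arg_cong[OF eq, of "\<lambda>\<zeta>. \<zeta> $ Inr i"] by (simp add: bundle_chart_def affine_coords_def xp yp)
    then show ?thesis using nz \<xi>(4) \<xi>'(4) unfolding \<xi>(5) \<xi>'(5) r_def by (simp add: field_simps)
  qed
  then have "\<xi> d = r *s \<xi>' d" by (simp add: vec_eq_iff)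
  then have "\<xi> e = r *s \<xi>' e" for e by (rule cotangent_eqI[OF \<xi>(1) \<xi>'(1) d px(2)])
  then have \<xi>r: "\<xi> = (\<lambda>e. r *s \<xi>' e)" by blast
  have r: "r \<noteq> 0" using nz by (simp add: r_def)
  have "L = L'"
  proof (intro equalityI subsetI)
    fix \<eta> assume "\<eta> \<in> L"
    then obtain t where "\<eta> = (\<lambda>e. (t * r) *s \<xi>' e)" unfolding \<xi>(2) \<xi>r by auto
    then show "\<eta> \<in> L'" unfolding \<xi>'(2) by blast
  next
    fix \<eta> assume "\<eta> \<in> L'"
    then obtain t where "\<eta> = (\<lambda>e. t *s \<xi>' e)" unfolding \<xi>'(2) by auto
    then have "\<eta> = (\<lambda>e. (t / r) *s \<xi> e)" unfolding \<xi>r using r by simp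
    then show "\<eta> \<in> L" unfolding \<xi>(2) by blast
  qed
  then show "x = y" by (simp add: xp yp pp)
qed

text \<open>This makes \<open>in_coords\<close> computable: the inverse chart takes \<open>(z, X)\<close> to the line spanned by the
covector with components \<open>X\<close>. The chosen homogeneous coordinates of that line agree with \<open>X\<close> up to
a factor \<open>s\<close>, which cancels in everything homogeneous of degree 0.\<close>

lemma bundle_chart_inverse:
  assumes A: "complex_atlas A" "c \<in> A" and B: "complex_atlas B" "d \<in> B"
    and z: "base_coords \<zeta> \<in> snd c ` (fst c \<inter> f -` fst d)"
  obtains L s where
    "inv_into (bundle_dom B f c d j) (bundle_chart c d j) (\<chi> k. if k = Inr j then 1 else \<zeta> $ k)
       = (coord_inv c (base_coords \<zeta>), L)"
    "s \<noteq> 0" "homog d L = s *s fibre_coords j \<zeta>" "affine_coords d j L = fibre_coords j \<zeta>"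
proof -
  define p where "p = coord_inv c (base_coords \<zeta>)"
  have p: "p \<in> fst c" "f p \<in> fst d" "snd c p = base_coords \<zeta>"
    using z complex_atlasD(4)[OF A] unfolding p_def by auto
  obtain \<xi> where \<xi>: "\<xi> \<in> cotangent B (f p)" "\<xi> d = fibre_coords j \<zeta>"
    using cotangent_extend[OF B p(2)] .
  have j: "fibre_coords j \<zeta> $ j = 1" by (simp add: fibre_coords_def)
  then have nz: "\<xi> d \<noteq> 0" by (auto simp: \<xi>(2))
  define L where "L = range (\<lambda>t::complex. \<lambda>e. t *s \<xi> e)"
  obtain s where s: "s \<noteq> 0" "homog d L = s *s fibre_coords j \<zeta>"
    using homog_line[of \<xi> d, OF nz] unfolding L_def \<xi>(2) by blast
  have aff: "affine_coords d j L = fibre_coords j \<zeta>"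
    unfolding affine_coords_def s(2) using s(1) j by (simp add: vec_eq_iff)
  have "\<xi> \<noteq> (\<lambda>_. 0)" using nz by auto
  then have "(p, L) \<in> proj_bundle B f"
    using \<xi>(1) unfolding proj_bundle_def L_def by blast
  then have dom: "(p, L) \<in> bundle_dom B f c d j"
    using p s j by (simp add: bundle_dom_def)
  have "bundle_chart c d j (p, L) = (\<chi> k. if k = Inr j then 1 else \<zeta> $ k)"
    unfolding bundle_chart_def fst_conv snd_conv aff p(3)
    by (auto simp: vec_eq_iff base_coords_def fibre_coords_def split: sum.splits)
  then have "inv_into (bundle_dom B f c d j) (bundle_chart c d j) (\<chi> k. if k = Inr j then 1 else \<zeta> $ k) = (p, L)"
    by (intro inv_into_f_eq inj_on_bundle_chart[OF A B(2)] dom)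
  then show ?thesis using that s aff unfolding p_def by blast
qed

section \<open>The two sides of the inequality in coordinates\<close>

lemma H1_dotc: "H1 g d q X = dotc (X v* inv_metric (g d q)) X"
  by (simp add: H1_def dotc_matrix)

text \<open>The components of the pullback \<open>f\<^sup>*(X\<^sub>i d\<eta>\<^sup>i)\<close>; this is the holomorphic row vector \<open>V\<close>.\<close>

definition pullback_covector ::
  "('a \<Rightarrow> 'b) \<Rightarrow> ('a, 'm::finite) chart \<Rightarrow> ('b, 'n::finite) chart \<Rightarrow> 'a \<Rightarrow> complex^'n \<Rightarrow> complex^'m" where
  "pullback_covector f c d p X = (\<chi> \<alpha>. \<Sum>i\<in>UNIV. fpartial f c d p i \<alpha> * X $ i)"

lemma pullback_covector_smult: "pullback_covector f c d p (s *s X) = s *s pullback_covector f c d p X"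
  by (simp add: pullback_covector_def vec_eq_iff sum_distrib_left mult_ac)

lemma dotc_smult_ratio:
  assumes "s \<noteq> 0"
  shows "dotc ((s *s V) v* K) (s *s V) / dotc ((s *s X) v* L) (s *s X) = dotc (V v* K) V / dotc (X v* L) X"
  using assms by (simp add: scalar_vector_matrix_assoc dotc_smult_left dotc_smult_right)

lemma Y1_eq:
  fixes f :: "'a \<Rightarrow> 'b" and c :: "('a, 'm::finite) chart" and d :: "('b, 'n::finite) chart"
    and h :: "('a, 'm) chart \<Rightarrow> 'a \<Rightarrow> complex^'m^'m" and p :: 'a and X :: "complex^'n"
  assumes s: "s \<noteq> 0" and L: "homog d L = s *s X"
  defines "V \<equiv> pullback_covector f c d p X"
  shows "Y1 h g f c d (p, L)
       = dotc (V v* inv_metric (h c p)) V / dotc (X v* inv_metric (g d (f p))) X"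
proof -
  let ?X = "homog d L"
  let ?V = "pullback_covector f c d p ?X"
  have "Y1 h g f c d (p, L) = dotc (?V v* inv_metric (h c p)) ?V / H1 g d (f p) ?X"
    unfolding Y1_def Let_def dotc_matrix pullback_covector_def
    by (simp add: sum_distrib_left sum_distrib_right sum_divide_distrib mult_ac)
  then show ?thesis
    unfolding H1_dotc L pullback_covector_smult V_def by (simp only: dotc_smult_ratio[OF s])
qed

lemma sum4_swap:
  "(\<Sum>i\<in>I. \<Sum>j\<in>J. \<Sum>k\<in>K. \<Sum>l\<in>L. F i j k l) = (\<Sum>k\<in>K. \<Sum>l\<in>L. \<Sum>i\<in>I. \<Sum>j\<in>J. F i j k l)"
proof -
  have "(\<Sum>p\<in>I \<times> J. \<Sum>q\<in>K \<times> L. F (fst p) (snd p) (fst q) (snd q))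
      = (\<Sum>q\<in>K \<times> L. \<Sum>p\<in>I \<times> J. F (fst p) (snd p) (fst q) (snd q))"
    by (rule sum.swap)
  then show ?thesis by (simp add: sum.cartesian_product')
qed

lemma curv_form_eq:
  fixes f :: "'a \<Rightarrow> 'b" and c :: "('a, 'm::finite) chart" and d :: "('b, 'n::finite) chart"
    and h :: "('a, 'm) chart \<Rightarrow> 'a \<Rightarrow> complex^'m^'m" and p :: 'a and X :: "complex^'n"
  assumes s: "s \<noteq> 0" and L: "homog d L = s *s X"
  defines "V \<equiv> pullback_covector f c d p X" and "K \<equiv> inv_metric (h c p)"
  shows "curv_form h g f c d (p, L) $ a $ b = (case (a, b) of
      (Inl \<alpha>, Inl \<beta>) \<Rightarrow> dotc (V v* (K ** (\<chi> \<delta> \<gamma>. chern_curv h c p \<alpha> \<beta> \<gamma> \<delta>) ** K)) V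
          / dotc (X v* inv_metric (g d (f p))) X
    | _ \<Rightarrow> 0)"
proof -
  let ?X = "homog d L"
  let ?V = "pullback_covector f c d p ?X"
  have "(\<Sum>\<gamma>\<in>UNIV. \<Sum>\<delta>\<in>UNIV. \<Sum>\<mu>\<in>UNIV. \<Sum>\<nu>\<in>UNIV. \<Sum>k\<in>UNIV. \<Sum>l\<in>UNIV.
             R \<gamma> \<delta> * K $ \<gamma> $ \<nu> * K $ \<mu> $ \<delta> *
             fpartial f c d p k \<mu> * cnj (fpartial f c d p l \<nu>) * ?X $ k * cnj (?X $ l))
      = dotc (?V v* (K ** (\<chi> \<delta> \<gamma>. R \<gamma> \<delta>) ** K)) ?V" for R
  proof -
    have "(\<Sum>k\<in>UNIV. \<Sum>l\<in>UNIV. r * fpartial f c d p k \<mu> * cnj (fpartial f c d p l \<nu>) * ?X $ k * cnj (?X $ l))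
        = r * ?V $ \<mu> * cnj (?V $ \<nu>)" for r \<mu> \<nu>
      by (subst sum.swap) (simp add: pullback_covector_def sum_distrib_left sum_distrib_right mult_ac)
    then have "(\<Sum>\<gamma>\<in>UNIV. \<Sum>\<delta>\<in>UNIV. \<Sum>\<mu>\<in>UNIV. \<Sum>\<nu>\<in>UNIV. \<Sum>k\<in>UNIV. \<Sum>l\<in>UNIV.
             R \<gamma> \<delta> * K $ \<gamma> $ \<nu> * K $ \<mu> $ \<delta> *
             fpartial f c d p k \<mu> * cnj (fpartial f c d p l \<nu>) * ?X $ k * cnj (?X $ l))
      = (\<Sum>\<gamma>\<in>UNIV. \<Sum>\<delta>\<in>UNIV. \<Sum>\<mu>\<in>UNIV. \<Sum>\<nu>\<in>UNIV.
             R \<gamma> \<delta> * K $ \<gamma> $ \<nu> * K $ \<mu> $ \<delta> * ?V $ \<mu> * cnj (?V $ \<nu>))"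
      by simp
    also have "\<dots> = (\<Sum>\<mu>\<in>UNIV. \<Sum>\<nu>\<in>UNIV. \<Sum>\<gamma>\<in>UNIV. \<Sum>\<delta>\<in>UNIV.
             R \<gamma> \<delta> * K $ \<gamma> $ \<nu> * K $ \<mu> $ \<delta> * ?V $ \<mu> * cnj (?V $ \<nu>))"
      by (rule sum4_swap)
    also have "\<dots> = dotc (?V v* (K ** (\<chi> \<delta> \<gamma>. R \<gamma> \<delta>) ** K)) ?V"
      by (simp add: dotc_matrix matrix_matrix_mult_def sum_distrib_left sum_distrib_right mult_ac)
    finally show ?thesis .
  qed
  note R = this
  show ?thesis
    unfolding curv_form_def Let_def fst_conv snd_conv K_def[symmetric] R
    unfolding H1_dotc L pullback_covector_smult V_def[symmetric]
    by (cases a; cases b) (simp_all add: dotc_smult_ratio[OF s])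
qed

text \<open>The entry in row \<open>\<delta>\<close> and column \<open>\<gamma>\<close> of the matrix on the left is the definition of the Chern curvature,
since \<open>T\<close> is the transposed metric; components in fibre directions vanish because the metric is pulled
back from \<open>M\<close>.\<close>

lemma chern_curv_matrix:
  fixes \<zeta> :: "complex^('m::finite + 'n::finite)"
    and c :: "('a, 'm) chart" and h :: "('a, 'm) chart \<Rightarrow> 'a \<Rightarrow> complex^'m^'m"
  defines "T \<equiv> \<lambda>\<zeta> :: complex^('m + 'n). transpose (h c (coord_inv c (base_coords \<zeta>)))"
  assumes p: "coord_inv c (base_coords \<zeta>) = p" "snd c p = base_coords \<zeta>"
    and H: "\<And>\<gamma> \<delta>. twice_diff (\<lambda>z. h c (coord_inv c z) $ \<gamma> $ \<delta>) (base_coords \<zeta>)"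
  shows "wirtinger_mat \<i> b T \<zeta> ** inv_metric (h c p) ** wirtinger_mat (-\<i>) a T \<zeta>
           - wirtinger_mat (-\<i>) a (wirtinger_mat \<i> b T) \<zeta>
       = (case (a, b) of (Inl \<alpha>, Inl \<beta>) \<Rightarrow> (\<chi> \<delta> \<gamma>. chern_curv h c p \<alpha> \<beta> \<gamma> \<delta>) | _ \<Rightarrow> 0)"
proof -
  have D: "wirtinger_mat \<kappa> a T \<zeta> = (case a of
      Inl \<alpha> \<Rightarrow> (\<chi> \<delta> \<gamma>. wirtinger \<kappa> \<alpha> (\<lambda>z. h c (coord_inv c z) $ \<gamma> $ \<delta>) (base_coords \<zeta>))
    | Inr _ \<Rightarrow> 0)" for \<kappa> a
    using wirtinger_base[OF twice_diff_imp_differentiable[OF H]]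
    by (simp add: wirtinger_mat_def T_def transpose_def vec_eq_iff split: sum.split)
  have D2: "wirtinger_mat (-\<i>) a (wirtinger_mat \<i> b T) \<zeta> = (case (a, b) of
      (Inl \<alpha>, Inl \<beta>) \<Rightarrow>
        (\<chi> \<delta> \<gamma>. wirtinger (-\<i>) \<alpha> (wirtinger \<i> \<beta> (\<lambda>z. h c (coord_inv c z) $ \<gamma> $ \<delta>)) (base_coords \<zeta>))
    | _ \<Rightarrow> 0)"
    using wirtinger_base_second[OF H, of "-\<i>" a \<i> b]
    by (simp add: wirtinger_mat_def T_def transpose_def vec_eq_iff split: sum.split)
  show ?thesis
  proof (cases a; cases b)
    fix \<alpha> \<beta> assume ab: "a = Inl \<alpha>" "b = Inl \<beta>"
    have "(wirtinger_mat \<i> b T \<zeta> ** inv_metric (h c p) ** wirtinger_mat (-\<i>) a T \<zeta>) $ \<delta> $ \<gamma>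
        = (\<Sum>\<mu>\<in>UNIV. \<Sum>\<nu>\<in>UNIV. inv_metric (h c p) $ \<mu> $ \<nu> *
             wirtinger (-\<i>) \<alpha> (\<lambda>z. h c (coord_inv c z) $ \<gamma> $ \<nu>) (base_coords \<zeta>) *
             wirtinger \<i> \<beta> (\<lambda>z. h c (coord_inv c z) $ \<mu> $ \<delta>) (base_coords \<zeta>))" for \<delta> \<gamma>
      unfolding D ab
      by (subst sum.swap) (simp add: matrix_matrix_mult_def sum_distrib_left sum_distrib_right mult_ac)
    then show ?thesis
      using D2 by (simp add: ab vec_eq_iff chern_curv_def Let_def p wirt_eq_wirtinger wirt_bar_eq_wirtinger)
  qed (use D2 in \<open>auto simp: D matrix_mult_zero\<close>)
qed

theorem proposition1p4:
  fixes A :: "('a::{t2_space,second_countable_topology}, 'm::finite) chart set"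
    and B :: "('b::{t2_space,second_countable_topology}, 'n::finite) chart set"
    and h :: "('a, 'm) chart \<Rightarrow> 'a \<Rightarrow> complex^'m^'m"
    and g :: "('b, 'n) chart \<Rightarrow> 'b \<Rightarrow> complex^'n^'n"
    and f :: "'a \<Rightarrow> 'b"
    and c :: "('a, 'm) chart" and d :: "('b, 'n) chart" and j :: 'n
    and x :: "'a \<times> (('b, 'n) chart \<Rightarrow> complex^'n) set"
  assumes "complex_atlas A" and "hermitian_metric A h"
    and "complex_atlas B" and "hermitian_metric B g"
    and "holomorphic_map A B f"
    and "c \<in> A" and "d \<in> B" and "x \<in> bundle_dom B f c d j"
  shows "form_ge (UNIV - {Inr j})
           (ddbar B f c d j (Y1 h g f c d) x)
           ((\<chi> a b. ddbar B f c d j (log_inv_H1 g f d j) x $ a $ b * Y1 h g f c d x)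
            + curv_form h g f c d x)"
proof -
  note Ac = assms(1,6) and Bd = assms(3,7)
  define \<phi> where "\<phi> z = snd d (f (coord_inv c z))" for z
  define U where "U = snd c ` (fst c \<inter> f -` fst d)"
  define \<zeta>\<^sub>0 where "\<zeta>\<^sub>0 = bundle_chart c d j x"
  define T where "T \<zeta> = transpose (h c (coord_inv c (base_coords \<zeta>)))" for \<zeta> :: "complex^('m + 'n)"
  define K where "K \<zeta> = inv_metric (h c (coord_inv c (base_coords \<zeta>)))" for \<zeta> :: "complex^('m + 'n)"
  define V where "V \<zeta> = pullback_covector f c d (coord_inv c (base_coords \<zeta>)) (fibre_coords j \<zeta>)"
    for \<zeta> :: "complex^('m + 'n)"
  define G where "G \<zeta> = dotc (fibre_coords j \<zeta> v* inv_metric (g d (f (coord_inv c (base_coords \<zeta>)))))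
      (fibre_coords j \<zeta>)" for \<zeta> :: "complex^('m + 'n)"
  define Y where "Y \<zeta> = dotc (V \<zeta> v* K \<zeta>) (V \<zeta>) * inverse (G \<zeta>)" for \<zeta>

  have "open (f -` fst d)"
    using assms(5) complex_atlasD(1)[OF Bd] unfolding holomorphic_map_def
    by (auto intro: open_vimage)
  then have U: "open U" unfolding U_def by (rule open_chart_image[OF Ac])
  have holo: "holo_on U \<phi>"
    using assms(5-7) unfolding holomorphic_map_def U_def \<phi>_def by blast
  have \<phi>_hol: "complex_diff (\<lambda>z. \<phi> z $ i) z" if "z \<in> U" for i z
    by (rule complex_diff_component[OF holo that])
  have UM: "z \<in> snd c ` fst c" and Ud: "f (coord_inv c z) \<in> fst d" if "z \<in> U" for z
    using that complex_atlasD(4)[OF Ac] by (auto simp: U_def)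

  obtain p L where xp: "x = (p, L)" by force
  have p: "p \<in> fst c" "f p \<in> fst d" "homog d L $ j \<noteq> 0"
    using assms(8) by (auto simp: xp bundle_dom_def)
  have base0: "base_coords \<zeta>\<^sub>0 = snd c p"
    by (simp add: base_coords_def \<zeta>\<^sub>0_def bundle_chart_def xp vec_eq_iff)
  have z0: "base_coords \<zeta>\<^sub>0 \<in> U" using p by (auto simp: base0 U_def)
  have p0: "coord_inv c (base_coords \<zeta>\<^sub>0) = p"
    unfolding base0 by (rule complex_atlasD(4)[OF Ac p(1)])
  have evU: "\<forall>\<^sub>F \<zeta> in nhds \<zeta>\<^sub>0. base_coords \<zeta> \<in> U"
    using eventually_nhds_in_open[OF U z0] by (rule eventually_base_coords)

  have in_coords_Y1: "in_coords B f c d j (Y1 h g f c d) \<zeta> = Y \<zeta>"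
    and in_coords_log: "in_coords B f c d j (log_inv_H1 g f d j) \<zeta> = ln (inverse (G \<zeta>))"
    if z: "base_coords \<zeta> \<in> U" for \<zeta>
  proof -
    obtain L s where L: "inv_into (bundle_dom B f c d j) (bundle_chart c d j)
          (\<chi> k. if k = Inr j then 1 else \<zeta> $ k) = (coord_inv c (base_coords \<zeta>), L)"
        "s \<noteq> 0" "homog d L = s *s fibre_coords j \<zeta>" "affine_coords d j L = fibre_coords j \<zeta>"
      using bundle_chart_inverse[OF Ac Bd z[unfolded U_def]] .
    show "in_coords B f c d j (Y1 h g f c d) \<zeta> = Y \<zeta>"
      unfolding in_coords_def L(1) Y1_eq[OF L(2,3)] Y_def V_def K_def G_def
      by (simp add: divide_inverse)
    show "in_coords B f c d j (log_inv_H1 g f d j) \<zeta> = ln (inverse (G \<zeta>))"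
      unfolding in_coords_def L(1) log_inv_H1_def fst_conv snd_conv L(4) H1_dotc G_def ..
  qed

  \<comment> \<open>Filling in the dummy coordinate does not move the point \<open>\<zeta>\<^sub>0\<close>, so the coordinate expressions
  evaluate at \<open>\<zeta>\<^sub>0\<close> to the values at \<open>x\<close>.\<close>
  have "\<zeta>\<^sub>0 $ Inr j = 1"
    using p by (simp add: \<zeta>\<^sub>0_def bundle_chart_def affine_coords_def xp)
  then have fill: "(\<chi> k. if k = Inr j then 1 else \<zeta>\<^sub>0 $ k) = \<zeta>\<^sub>0" by (simp add: vec_eq_iff)
  have inv0: "inv_into (bundle_dom B f c d j) (bundle_chart c d j) \<zeta>\<^sub>0 = x"
    unfolding \<zeta>\<^sub>0_def by (rule inv_into_f_f[OF inj_on_bundle_chart[OF Ac Bd(2)] assms(8)])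
  have Y1x: "Y1 h g f c d x = Y \<zeta>\<^sub>0"
    using in_coords_Y1[OF z0] unfolding in_coords_def fill inv0 .
  obtain L' s where L': "inv_into (bundle_dom B f c d j) (bundle_chart c d j)
        (\<chi> k. if k = Inr j then 1 else \<zeta>\<^sub>0 $ k) = (coord_inv c (base_coords \<zeta>\<^sub>0), L')"
      and s: "s \<noteq> 0" and "homog d L' = s *s fibre_coords j \<zeta>\<^sub>0"
    using bundle_chart_inverse[OF Ac Bd z0[unfolded U_def]] .
  then have hom: "homog d L = s *s fibre_coords j \<zeta>\<^sub>0"
    using L' unfolding fill inv0 xp by simp

  have pos_def_h: "hermitian_pos_def (h c (coord_inv c z))" if "z \<in> U" for z
    using assms(2,6) complex_atlasD(6)[OF Ac UM[OF that]] unfolding hermitian_metric_def by blast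
  have pos_def_g: "hermitian_pos_def (g d (f (coord_inv c z)))" if "z \<in> U" for z
    using assms(4,7) Ud[OF that] unfolding hermitian_metric_def by blast
  have "smooth_on (snd c ` fst c) (\<lambda>z. h c (coord_inv c z))"
    using assms(2,6) unfolding hermitian_metric_def by blast
  then have H2: "twice_diff (\<lambda>z. h c (coord_inv c z) $ \<alpha> $ \<beta>) (base_coords \<zeta>\<^sub>0)" for \<alpha> \<beta>
    by (intro twice_diff_component twice_diff_if_smooth_on[OF complex_atlasD(3)[OF Ac] UM[OF z0]])
  have base2: "twice_diff base_coords \<zeta>\<^sub>0"
    by (rule twice_diff_bounded_linear_fun[OF bounded_linear_base_coords])
  have T2: "twice_diff (\<lambda>\<zeta>. T \<zeta> $ i $ k) \<zeta>\<^sub>0" for i k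
    unfolding T_def using twice_diff_compose[OF H2 base2] by (simp add: transpose_def)
  have K2: "twice_diff (\<lambda>\<zeta>. K \<zeta> $ i $ k) \<zeta>\<^sub>0" for i k
    unfolding K_def inv_metric_def
  proof (rule twice_diff_matrix_inv)
    show "\<forall>\<^sub>F \<zeta> in nhds \<zeta>\<^sub>0. invertible (transpose (h c (coord_inv c (base_coords \<zeta>))))"
      using evU by (rule eventually_mono) (rule invertible_transpose_metric[OF pos_def_h])
  qed (fact T2[unfolded T_def])

  have \<phi>2: "twice_diff \<phi> (base_coords \<zeta>\<^sub>0)"
    by (rule twice_diff_vec, rule twice_diff_if_complex_diff[OF U z0 \<phi>_hol])
  have fibre2: "twice_diff (\<lambda>\<zeta>. fibre_coords j \<zeta> $ i) \<zeta>\<^sub>0" for i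
    by (rule twice_diff_if_complex_diff[OF open_UNIV UNIV_I complex_diff_fibre_coords])
  have \<phi>z0: "\<phi> (base_coords \<zeta>\<^sub>0) \<in> snd d ` fst d" using Ud[OF z0] by (simp add: \<phi>_def)
  have "smooth_on (snd d ` fst d) (\<lambda>\<eta>. g d (coord_inv d \<eta>))"
    using assms(4,7) unfolding hermitian_metric_def by blast
  then have g2: "twice_diff (\<lambda>\<eta>. g d (coord_inv d \<eta>) $ i $ k) (\<phi> (base_coords \<zeta>\<^sub>0))" for i k
    by (intro twice_diff_component twice_diff_if_smooth_on[OF complex_atlasD(3)[OF Bd] \<phi>z0])
  have "twice_diff (\<lambda>\<zeta>. g d (coord_inv d (\<phi> (base_coords \<zeta>))) $ i $ k) \<zeta>\<^sub>0" for i k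
    by (rule twice_diff_compose[OF twice_diff_compose[OF g2 \<phi>2] base2])
  then have gf2: "twice_diff (\<lambda>\<zeta>. g d (f (coord_inv c (base_coords \<zeta>))) $ i $ k) \<zeta>\<^sub>0" for i k
    by (rule twice_diff_cong)
       (use evU in \<open>rule eventually_mono, simp add: \<phi>_def complex_atlasD(4)[OF Bd Ud]\<close>)
  have gi2: "twice_diff (\<lambda>\<zeta>. inv_metric (g d (f (coord_inv c (base_coords \<zeta>)))) $ i $ k) \<zeta>\<^sub>0" for i k
    unfolding inv_metric_def
  proof (rule twice_diff_matrix_inv)
    show "\<forall>\<^sub>F \<zeta> in nhds \<zeta>\<^sub>0. invertible (transpose (g d (f (coord_inv c (base_coords \<zeta>)))))"
      using evU by (rule eventually_mono) (rule invertible_transpose_metric[OF pos_def_g])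
    show "twice_diff (\<lambda>\<zeta>. transpose (g d (f (coord_inv c (base_coords \<zeta>)))) $ i $ j) \<zeta>\<^sub>0" for i j
      using gf2 by (simp add: transpose_def)
  qed
  have G2: "twice_diff G \<zeta>\<^sub>0"
    unfolding G_def dotc_def vector_matrix_mult_def
    by (simp, intro twice_diff_sum twice_diff_mult twice_diff_cnj gi2 fibre2)
  have G_pos: "\<forall>\<^sub>F \<zeta> in nhds \<zeta>\<^sub>0. G \<zeta> \<in> \<real> \<and> 0 < Re (G \<zeta>)"
    using evU
  proof (rule eventually_mono)
    fix \<zeta> :: "complex^('m + 'n)"
    assume "base_coords \<zeta> \<in> U"
    note pd = pos_def_g[OF this]
    show "G \<zeta> \<in> \<real> \<and> 0 < Re (G \<zeta>)"
      unfolding G_def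
      using dotc_hermitian_real[OF adjoint_inv_metric[OF pd]] inv_metric_pos[OF pd fibre_coords_nonzero]
      by blast
  qed

  have f_hol: "complex_diff (wirt \<alpha> (\<lambda>z. \<phi> z $ i)) z" if "z \<in> U" for i \<alpha> z
    by (rule complex_diff_wirt[OF U that \<phi>_hol])
  have V_eq: "V \<zeta> $ \<alpha> = (\<Sum>i\<in>UNIV. wirt \<alpha> (\<lambda>z. \<phi> z $ i) (base_coords \<zeta>) * fibre_coords j \<zeta> $ i)"
    if "base_coords \<zeta> \<in> U" for \<zeta> \<alpha>
    unfolding V_def pullback_covector_def fpartial_def \<phi>_def
    using complex_atlasD(5)[OF Ac UM[OF that]] by simp
  have V_ev: "\<forall>\<^sub>F \<zeta> in nhds \<zeta>\<^sub>0.
      (\<Sum>i\<in>UNIV. wirt \<alpha> (\<lambda>z. \<phi> z $ i) (base_coords \<zeta>) * fibre_coords j \<zeta> $ i) = V \<zeta> $ \<alpha>" for \<alpha>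
    using evU by (rule eventually_mono) (rule V_eq[symmetric])
  have V2: "twice_diff (\<lambda>\<zeta>. V \<zeta> $ \<alpha>) \<zeta>\<^sub>0" for \<alpha>
    by (rule twice_diff_cong[OF _ V_ev], intro twice_diff_sum twice_diff_mult fibre2
        twice_diff_compose[OF twice_diff_if_complex_diff[OF U z0 f_hol] base2])
  \<comment> \<open>The factors \<open>f\<^sup>i\<^sub>\<alpha>\<close> are holomorphic in \<open>z\<close> and the factors \<open>X\<^sub>i\<close> are coordinates or constants.\<close>
  have V_hol: "\<forall>\<^sub>F \<zeta> in nhds \<zeta>\<^sub>0. wirtinger \<i> b (\<lambda>\<zeta>. V \<zeta> $ \<alpha>) \<zeta> = 0" for b \<alpha>
    using wirtinger_cong_eventually[OF V_ev[of \<alpha>], of \<i> b] evU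
  proof eventually_elim
    case (elim \<zeta>)
    have "complex_diff (\<lambda>\<zeta>. \<Sum>i\<in>UNIV. wirt \<alpha> (\<lambda>z. \<phi> z $ i) (base_coords \<zeta>) * fibre_coords j \<zeta> $ i) \<zeta>"
      by (intro complex_diff_sum complex_diff_mult complex_diff_fibre_coords
          complex_diff_compose_linear[OF f_hol[OF elim(2)] bounded_linear_base_coords base_coords_smult])
    from wirt_bar_complex_diff[OF this] show ?case unfolding elim(1)[symmetric] .
  qed

  have KT: "\<forall>\<^sub>F \<zeta> in nhds \<zeta>\<^sub>0. K \<zeta> ** T \<zeta> = mat 1"
    using evU unfolding K_def T_def by (rule eventually_mono) (rule inv_metric_mult[OF pos_def_h])
  have T_adj: "\<forall>\<^sub>F \<zeta> in nhds \<zeta>\<^sub>0. adjoint_mat (T \<zeta>) = T \<zeta>"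
    using evU unfolding T_def by (rule eventually_mono) (rule adjoint_transpose_metric[OF pos_def_h])
  have K_pos: "0 \<le> Re (dotc (u v* K \<zeta>\<^sub>0) u)" for u
    using inv_metric_pos[OF pos_def_h[OF z0], of u] unfolding K_def
    by (cases "u = 0") (auto simp: less_imp_le)

  show ?thesis
  proof (rule form_ge_of_square[OF KT T_adj T2 K2 V2 V_hol G2 G_pos K_pos])
    fix a b
    have ev_Y: "\<forall>\<^sub>F \<zeta> in nhds \<zeta>\<^sub>0. in_coords B f c d j (Y1 h g f c d) \<zeta> = Y \<zeta>"
      and ev_log: "\<forall>\<^sub>F \<zeta> in nhds \<zeta>\<^sub>0. in_coords B f c d j (log_inv_H1 g f d j) \<zeta> = ln (inverse (G \<zeta>))"
      using evU by (auto elim!: eventually_mono simp: in_coords_Y1 in_coords_log)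
    have wirt_cong: "wirt a (wirt_bar b F) \<zeta>\<^sub>0 = wirt a (wirt_bar b F') \<zeta>\<^sub>0"
      if "\<forall>\<^sub>F \<zeta> in nhds \<zeta>\<^sub>0. F \<zeta> = F' \<zeta>" for F F'
      unfolding wirt_eq_wirtinger wirt_bar_eq_wirtinger
      by (intro wirtinger_cong wirtinger_cong_eventually that)
    show "ddbar B f c d j (Y1 h g f c d) x $ a $ b
        = wirt a (wirt_bar b (\<lambda>\<zeta>. dotc (V \<zeta> v* K \<zeta>) (V \<zeta>) * inverse (G \<zeta>))) \<zeta>\<^sub>0"
      using wirt_cong[OF ev_Y] by (simp add: ddbar_def Y_def flip: \<zeta>\<^sub>0_def)
    have R: "wirtinger_mat \<i> b T \<zeta>\<^sub>0 ** K \<zeta>\<^sub>0 ** wirtinger_mat (- \<i>) a T \<zeta>\<^sub>0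
          - wirtinger_mat (- \<i>) a (wirtinger_mat \<i> b T) \<zeta>\<^sub>0
        = (case (a, b) of (Inl \<alpha>, Inl \<beta>) \<Rightarrow> (\<chi> \<delta> \<gamma>. chern_curv h c p \<alpha> \<beta> \<gamma> \<delta>) | _ \<Rightarrow> 0)"
      unfolding T_def K_def p0 
      by (rule chern_curv_matrix[where h = h, OF p0 base0[symmetric] H2])
    have "curv_form h g f c d x $ a $ b =
        dotc (V \<zeta>\<^sub>0 v* (K \<zeta>\<^sub>0 ** (wirtinger_mat \<i> b T \<zeta>\<^sub>0 ** K \<zeta>\<^sub>0 ** wirtinger_mat (- \<i>) a T \<zeta>\<^sub>0
          - wirtinger_mat (- \<i>) a (wirtinger_mat \<i> b T) \<zeta>\<^sub>0) ** K \<zeta>\<^sub>0)) (V \<zeta>\<^sub>0) / G \<zeta>\<^sub>0"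
      unfolding R
      unfolding xp curv_form_eq[OF s hom] V_def K_def G_def p0
      by (cases a; cases b) (simp_all add: matrix_mult_zero)
    then show "((\<chi> a b. ddbar B f c d j (log_inv_H1 g f d j) x $ a $ b * Y1 h g f c d x)
          + curv_form h g f c d x) $ a $ b
        = wirt a (wirt_bar b (\<lambda>\<zeta>. ln (inverse (G \<zeta>)))) \<zeta>\<^sub>0 *
            (dotc (V \<zeta>\<^sub>0 v* K \<zeta>\<^sub>0) (V \<zeta>\<^sub>0) * inverse (G \<zeta>\<^sub>0)) +
          dotc (V \<zeta>\<^sub>0 v* (K \<zeta>\<^sub>0 ** (wirtinger_mat \<i> b T \<zeta>\<^sub>0 ** K \<zeta>\<^sub>0 ** wirtinger_mat (- \<i>) a T \<zeta>\<^sub>0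
            - wirtinger_mat (- \<i>) a (wirtinger_mat \<i> b T) \<zeta>\<^sub>0) ** K \<zeta>\<^sub>0)) (V \<zeta>\<^sub>0) / G \<zeta>\<^sub>0"
      using wirt_cong[OF ev_log] by (simp add: Y1x Y_def ddbar_def flip: \<zeta>\<^sub>0_def)
  qed
qed

end
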